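(* Let $\mathfrak R$ be a total Quantum Term Rewrite System (QTRS). Then $\mathrm{NF}_{\mathfrak R}$ is exactly the set of well-typed ground terms equivalent (for $\equiv$) to values.
   Context: **Syntax.** $\mathcal X$ is a countable set of variables; $\mathcal A,\mathcal C,\mathcal F$ are pairwise disjoint signatures (symbols $b$ with arity $\mathrm{ar}(b)\in\mathbb N$) of amplitude, constructor and function symbols. Constructors include a unit $()$, $|0\rangle$, $|1\rangle$, $\mathtt 0$ (arity 0), $\mathtt S$ (arity 1), pairing $(\cdot,\cdot)$ (arity 2), $[\,]$ (arity 0) and list-cons $h::t$ (arity 2). Grammar: naturals $\iota::=x\mid\mathtt 0\mid\mathtt S(\iota)$; amplitudes $\alpha::=\mathtt a(\iota,\dots,\iota)\mid\alpha\cdot\alpha\mid\alpha+\alpha$; terms $t::=x\mid c(t,\dots,t)\mid f(t,\dots,t)\mid\alpha\cdot t\mid t+t$; values $v::=c(v,\dots,v)\mid\alpha\cdot v\ (\alpha\text{ ground})\mid v+v$. A term or amplitude is ground if it has no variable; $\mathscr T_0$ is the set of ground terms. A term is classical if it contains neither $+$ nor $\alpha\cdot$. A substitution $\sigma$ maps variables to values. **Amplitudes.** Each $\mathtt a\in\mathcal A$ has a total interpretation $[\![\mathtt a]\!]:\mathbb N^{\mathrm{ar}(\mathtt a)}\to\mathbb C$, extended to ground amplitudes in the obvious way (sums to sums, products to products, $\mathtt S^n(\mathtt 0)$ to $n$). For a non-ground $\alpha$, $[\![\alpha]\!]=\lambda$ means $[\![\alpha\sigma]\!]=\lambda$ for every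 $\sigma$ such that $\alpha\sigma$ is a ground amplitude. **Equivalence.** $\equiv$ is the smallest equivalence relation on terms, closed under all term contexts ($s\equiv t\Rightarrow C[s]\equiv C[t]$), with: $t_1+t_2\equiv t_2+t_1$; $t_1+(t_2+t_3)\equiv(t_1+t_2)+t_3$; $s+\alpha\cdot t\equiv s$ if $[\![\alpha]\!]=0$; $\alpha\cdot t\equiv t$ if $[\![\alpha]\!]=1$; $\alpha\cdot(\beta\cdot t)\equiv(\alpha\cdot\beta)\cdot t$; $\alpha\cdot(t_1+t_2)\equiv\alpha\cdot t_1+\alpha\cdot t_2$; $\alpha\cdot t+\beta\cdot t\equiv(\alpha+\beta)\cdot t$; and, for $b\in\mathcal C\uplus\mathcal F$, $b(\dots,\alpha\cdot t,\dots)\equiv\alpha\cdot b(\dots,t,\dots)$ and $b(\dots,t_1+t_2,\dots)\equiv b(\dots,t_1,\dots)+b(\dots,t_2,\dots)$. A canonical form of $t$ is a term $\sum_{i=1}^n\alpha_i\cdot t_i\equiv t$ with the $t_i$ pairwise distinct classical terms and $[\![\alpha_i]\!]\neq0$; $\mathrm{CAN}$ is the set of canonical forms. **STRS.** A rewrite rule is $l\to r$ with $l=f(p_1,\dots,p_n)$, $f\in\mathcal F$, each $p_i$ a classical term without function symbols, and $\mathrm{Var}(r)\subseteq\mathrm{Var}(l)$. An STRS $\mathfrak R$ consists of $\mathcal A,\mathcal C,\mathcal F,\mathcal X$, a set $\mathcal R$ of orthogonal rules (left-linear and with pairwise non-overlapping left-hand sides), and a main symbol $f\in\mathcal F$. **Reduction.**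 Evaluation contexts: $E::=\diamond\mid b(v_1,\dots,v_{i-1},E,t_{i+1},\dots,t_n)$ with $b\in\mathcal C\uplus\mathcal F$ and $v_j$ values. $\to_{\mathfrak R}\subseteq\mathscr T_0\times\mathscr T_0$ is defined inductively by: (C) if $l\to r\in\mathcal R$ and $E[l\sigma]$ is classical then $E[l\sigma]\to_{\mathfrak R}E[r\sigma]$; (E) if $s\equiv s'\to_{\mathfrak R}t'\equiv t$ then $s\to_{\mathfrak R}t$; (Q) if $\sum_i\alpha_i\cdot s_i\in\mathrm{CAN}$, $s_i\to^?_{\mathfrak R}t_i$ for all $i$, and $s_i\to_{\mathfrak R}t_i$ for some $i$, then $\sum_i\alpha_i\cdot s_i\to_{\mathfrak R}\sum_i\alpha_i\cdot t_i$. Here $s\to^?_{\mathfrak R}t$ iff ($s\in\mathrm{NF}_{\mathfrak R}$ and $t=s$) or $s\to_{\mathfrak R}t$, and $\mathrm{NF}_{\mathfrak R}=\{s\in\mathscr T_0\mid\nexists t,\ s\to_{\mathfrak R}t\}$ is the set of normal forms. $\to^*_{\mathfrak R}$ is the reflexive transitive closure. **Types.** There is a countable set of basic types (containing $\mathbb 1$, $\mathtt{Qbit}$, $\mathtt{nat}$, lists, pairs). Each $b\in\mathcal C\uplus\mathcal F$ has a unique signature $T_1\times\dots\times T_n\to T$ ($n=\mathrm{ar}(b)$), with the expected ones for the constructors above (polymorphic constructors have one copy per type). Quantum types form the least set containing $\mathtt{Qbit}$ and every $T$ such that some $c\in\mathcal C$ has signature $T_1\times\dots\times T_n\to T$ with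 some $T_i$ quantum; other types are classical. Contexts $\Gamma$ (non-linear), $\Delta$ (linear) are sets of typed distinct variables; contexts written together ($\Gamma,\Delta$ or $\Gamma;\Delta$) have disjoint domains. $\mathrm{Sub}_0(\Theta)$ is the set of substitutions $\sigma$ with $x\sigma$ a well-typed value of type $T$ for each $x:T\in\Theta$. Amplitude judgments $\Gamma\Vdash\alpha$: $\Gamma\Vdash\mathtt a(\iota_1,\dots,\iota_n)$ if $\Gamma;\varnothing\vdash\iota_i:\mathtt{nat}$ for all $i$; closed under $+$ and $\cdot$. Term judgments $\Gamma;\Delta\vdash_{\mathfrak R}t:T$: (var) $\Gamma,x:C;\varnothing\vdash x:C$ for $C$ classical and $\Gamma;x:Q\vdash x:Q$ for $Q$ quantum; (equiv) from $\Gamma;\Delta\vdash s:T$, $s\equiv t$, and the variables of $t$ in $\mathrm{Dom}(\Gamma\cup\Delta)$, infer $\Gamma;\Delta\vdash t:T$; (symb) if $b$ has signature $T_1\times\dots\times T_n\to T$ and $\Gamma;\Delta_i\vdash t_i:T_i$ for all $i$, then $\Gamma;\Delta_1,\dots,\Delta_n\vdash b(t_1,\dots,t_n):T$; (sup) if $Q$ is quantum, $\Gamma;\Delta\vdash t_i:Q$ and $\Gamma\Vdash\alpha_i$ for all $i$, $\sum_i|[\![\alpha_i\sigma]\!]|^2=1$ for all $\sigma\in\mathrm{Sub}_0(\Gamma)$, and $t_i\perp_{\mathfrak R}t_j$ for $i\ne j$, then $\Gamma;\Delta\vdash\sum_i\alpha_i\cdot t_i:Q$. $\vdash_{\mathfrak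 R}t:T$ abbreviates $\varnothing;\varnothing\vdash_{\mathfrak R}t:T$. Orthogonality: $\delta_\perp$ is the partial map on pairs of classical terms with $\delta_\perp(t,t)=1$ and $\delta_\perp(s,t)=0$ if $s=C[|q\rangle,s_1,\dots,s_n]$, $t=C[|1-q\rangle,t_1,\dots,t_n]$ for some $(n+1)$-hole context $C$, $q\in\{0,1\}$ and terms $s_i,t_i$. For $s,t$ with $\Gamma;\Delta\vdash s:T$, $\Gamma;\Delta\vdash t:T$: $s\perp_{\mathfrak R}t$ iff for all $\sigma\in\mathrm{Sub}_0(\Gamma\cup\Delta)$, $s\sigma\to^*_{\mathfrak R}\sum_{i=1}^n\alpha_i\cdot v_i\in\mathrm{CAN}$ and $t\sigma\to^*_{\mathfrak R}\sum_{j=1}^m\beta_j\cdot w_j\in\mathrm{CAN}$ with $v_i,w_j$ classical values, every $\delta_\perp(v_i,w_j)$ is defined, and $\sum_{i,j}[\![\alpha_i]\!][\![\beta_j]\!]^*\delta_\perp(v_i,w_j)=0$. **QTRS.** For $b$ with signature $T_1\times\dots\times T_n\to T$, $\mathrm{In}(b)$ is the set of tuples $\overline v=(v_1,\dots,v_n)$ of values with $\vdash_{\mathfrak R}v_i:T_i$; $\overline v\perp_{\mathfrak R}\overline w$ iff $v_i\perp_{\mathfrak R}w_i$ for some $i$. $f\in\mathcal F$ is an isometry if $\overline v\perp_{\mathfrak R}\overline w$ implies $f(\overline v)\perp_{\mathfrak R}f(\overline w)$ for all $\overline v,\overline w\in\mathrm{In}(f)$. A QTRS is an STRS whose function symbols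 are all isometries and such that for each rule $l\to r$ and all $\Gamma,\Delta,T$, $\Gamma;\Delta\vdash_{\mathfrak R}l:T$ implies $\Gamma;\Delta\vdash_{\mathfrak R}r:T$. **Total.** A QTRS is total if for any $f\in\mathcal F$ and any $\overline v\in\mathrm{In}(f)$ there exist a substitution $\sigma$ and a rule $l\to r\in\mathcal R$ with $l\sigma=f(\overline v)$.
   Formalization: The normal forms are restricted to well-typed ones: the well-typed elements of NF are exactly the well-typed ground terms equivalent to values. Without this the claim fails in every system, since the ill-typed value S(|0⟩) is a normal form. *)

theory Defs
  imports Complex_Main "HOL-Library.Countable"
begin

section \<open>Syntax\<close>

datatype 'b ty =
    TUnit | TQbit | TNat | TList "'b ty" | TPair "'b ty" "'b ty" | TBase 'b

text \<open>\<open>Ket False\<close> and \<open>Ket True\<close> are the two basis states. Polymorphic constructors carry their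
  type instance, so that every symbol has a unique signature. The constructors an individual
  system adds to the built-in ones are \<open>Other c\<close>.\<close>

datatype ('c, 'b) con =
    Unit | Ket bool | Zero | Succ | MkPair "'b ty" "'b ty" | LNil "'b ty" | LCons "'b ty" | Other 'c

datatype ('c, 'f, 'b) sym = Con "('c, 'b) con" | Fun 'f

datatype (nvars: 'x) nexp = NVar 'x | NZero | NSucc "'x nexp"

datatype (dead 'a, avars: 'x) amp =
    Amp 'a "'x nexp list" | AMul "('a, 'x) amp" "('a, 'x) amp" | AAdd "('a, 'x) amp" "('a, 'x) amp"

datatype (dead 'a, dead 'c, dead 'f, tvars: 'x, dead 'b) trm =
    Var 'x
  | App "('c, 'f, 'b) sym" "('a, 'c, 'f, 'x, 'b) trm list"
  | Scale "('a, 'x) amp" "('a, 'c, 'f, 'x, 'b) trm"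
  | Plus "('a, 'c, 'f, 'x, 'b) trm" "('a, 'c, 'f, 'x, 'b) trm"

record ('a, 'c, 'f, 'x, 'b) strs =
  amp_syms :: "'a set"
  amp_ar :: "'a \<Rightarrow> nat"
  amp_int :: "'a \<Rightarrow> nat list \<Rightarrow> complex"
  con_syms :: "'c set"
  con_sig :: "'c \<Rightarrow> 'b ty list \<times> 'b ty"
  fun_syms :: "'f set"
  fun_sig :: "'f \<Rightarrow> 'b ty list \<times> 'b ty"
  rules :: "(('a, 'c, 'f, 'x, 'b) trm \<times> ('a, 'c, 'f, 'x, 'b) trm) set"
  main_sym :: 'f

fun sym_sig :: "('a, 'c, 'f, 'x, 'b) strs \<Rightarrow> ('c, 'f, 'b) sym \<Rightarrow> 'b ty list \<times> 'b ty" where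
  "sym_sig R (Con Unit) = ([], TUnit)"
| "sym_sig R (Con (Ket q)) = ([], TQbit)"
| "sym_sig R (Con Zero) = ([], TNat)"
| "sym_sig R (Con Succ) = ([TNat], TNat)"
| "sym_sig R (Con (MkPair T U)) = ([T, U], TPair T U)"
| "sym_sig R (Con (LNil T)) = ([], TList T)"
| "sym_sig R (Con (LCons T)) = ([T, TList T], TList T)"
| "sym_sig R (Con (Other c)) = con_sig R c"
| "sym_sig R (Fun f) = fun_sig R f"

definition sym_ar :: "('a, 'c, 'f, 'x, 'b) strs \<Rightarrow> ('c, 'f, 'b) sym \<Rightarrow> nat" where
  "sym_ar R b = length (fst (sym_sig R b))"

definition sym_in :: "('a, 'c, 'f, 'x, 'b) strs \<Rightarrow> ('c, 'f, 'b) sym \<Rightarrow> bool" where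
  "sym_in R b \<longleftrightarrow>
     (case b of Con (Other c) \<Rightarrow> c \<in> con_syms R | Con _ \<Rightarrow> True | Fun f \<Rightarrow> f \<in> fun_syms R)"

primrec wf_amp :: "('a, 'c, 'f, 'x, 'b) strs \<Rightarrow> ('a, 'x) amp \<Rightarrow> bool" where
  "wf_amp R (Amp a ns) \<longleftrightarrow> a \<in> amp_syms R \<and> length ns = amp_ar R a"
| "wf_amp R (AMul \<alpha> \<beta>) \<longleftrightarrow> wf_amp R \<alpha> \<and> wf_amp R \<beta>"
| "wf_amp R (AAdd \<alpha> \<beta>) \<longleftrightarrow> wf_amp R \<alpha> \<and> wf_amp R \<beta>"

fun wf_trm :: "('a, 'c, 'f, 'x, 'b) strs \<Rightarrow> ('a, 'c, 'f, 'x, 'b) trm \<Rightarrow> bool" where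
  "wf_trm R (Var x) \<longleftrightarrow> True"
| "wf_trm R (App b ts) \<longleftrightarrow> sym_in R b \<and> length ts = sym_ar R b \<and> (\<forall>t \<in> set ts. wf_trm R t)"
| "wf_trm R (Scale \<alpha> t) \<longleftrightarrow> wf_amp R \<alpha> \<and> wf_trm R t"
| "wf_trm R (Plus s t) \<longleftrightarrow> wf_trm R s \<and> wf_trm R t"

definition ground_terms :: "('a, 'c, 'f, 'x, 'b) strs \<Rightarrow> ('a, 'c, 'f, 'x, 'b) trm set" where
  "ground_terms R = {t. wf_trm R t \<and> tvars t = {}}"

fun classical :: "('a, 'c, 'f, 'x, 'b) trm \<Rightarrow> bool" where
  "classical (Var x) \<longleftrightarrow> True"
| "classical (App b ts) \<longleftrightarrow> (\<forall>t \<in> set ts. classical t)"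
| "classical (Scale \<alpha> t) \<longleftrightarrow> False"
| "classical (Plus s t) \<longleftrightarrow> False"

fun no_funs :: "('a, 'c, 'f, 'x, 'b) trm \<Rightarrow> bool" where
  "no_funs (Var x) \<longleftrightarrow> True"
| "no_funs (App b ts) \<longleftrightarrow> (\<nexists>f. b = Fun f) \<and> (\<forall>t \<in> set ts. no_funs t)"
| "no_funs (Scale \<alpha> t) \<longleftrightarrow> no_funs t"
| "no_funs (Plus s t) \<longleftrightarrow> no_funs s \<and> no_funs t"

inductive is_value :: "('a, 'c, 'f, 'x, 'b) strs \<Rightarrow> ('a, 'c, 'f, 'x, 'b) trm \<Rightarrow> bool"
  for R where
  value_con: "\<lbrakk>sym_in R (Con c); length vs = sym_ar R (Con c); \<forall>v \<in> set vs. is_value R v\<rbrakk>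
    \<Longrightarrow> is_value R (App (Con c) vs)"
| value_scale: "\<lbrakk>wf_amp R \<alpha>; avars \<alpha> = {}; is_value R v\<rbrakk> \<Longrightarrow> is_value R (Scale \<alpha> v)"
| value_plus: "\<lbrakk>is_value R v; is_value R w\<rbrakk> \<Longrightarrow> is_value R (Plus v w)"


section \<open>Amplitudes\<close>

primrec neval :: "('x \<Rightarrow> nat) \<Rightarrow> 'x nexp \<Rightarrow> nat" where
  "neval \<rho> (NVar x) = \<rho> x"
| "neval \<rho> NZero = 0"
| "neval \<rho> (NSucc n) = Suc (neval \<rho> n)"

primrec aeval :: "('a, 'c, 'f, 'x, 'b) strs \<Rightarrow> ('x \<Rightarrow> nat) \<Rightarrow> ('a, 'x) amp \<Rightarrow> complex" where
  "aeval R \<rho> (Amp a ns) = amp_int R a (map (neval \<rho>) ns)"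
| "aeval R \<rho> (AMul \<alpha> \<beta>) = aeval R \<rho> \<alpha> * aeval R \<rho> \<beta>"
| "aeval R \<rho> (AAdd \<alpha> \<beta>) = aeval R \<rho> \<alpha> + aeval R \<rho> \<beta>"

text \<open>A substitution turns \<open>\<alpha>\<close> into a ground amplitude iff it maps the variables of \<open>\<alpha>\<close> to
  numerals, so the ground instances of \<open>\<alpha>\<close> are given by the valuations of its variables in the
  natural numbers.\<close>

definition amp_is :: "('a, 'c, 'f, 'x, 'b) strs \<Rightarrow> ('a, 'x) amp \<Rightarrow> complex \<Rightarrow> bool" where
  "amp_is R \<alpha> z \<longleftrightarrow> (\<forall>\<rho>. aeval R \<rho> \<alpha> = z)"

text \<open>The interpretation of ground amplitudes, for which the valuation is irrelevant.\<close>

definition aval :: "('a, 'c, 'f, 'x, 'b) strs \<Rightarrow> ('a, 'x) amp \<Rightarrow> complex" where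
  "aval R \<alpha> = aeval R (\<lambda>_. 0) \<alpha>"


section \<open>Equivalence and canonical forms\<close>

inductive trm_equiv :: "('a, 'c, 'f, 'x, 'b) strs \<Rightarrow>
    ('a, 'c, 'f, 'x, 'b) trm \<Rightarrow> ('a, 'c, 'f, 'x, 'b) trm \<Rightarrow> bool" for R where
  equiv_refl: "wf_trm R t \<Longrightarrow> trm_equiv R t t"
| equiv_sym: "trm_equiv R s t \<Longrightarrow> trm_equiv R t s"
| equiv_trans: "\<lbrakk>trm_equiv R s t; trm_equiv R t u\<rbrakk> \<Longrightarrow> trm_equiv R s u"
| ctx_app: "\<lbrakk>trm_equiv R s t; wf_trm R (App b (us @ s # vs))\<rbrakk>
    \<Longrightarrow> trm_equiv R (App b (us @ s # vs)) (App b (us @ t # vs))"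
| ctx_scale: "\<lbrakk>trm_equiv R s t; wf_amp R \<alpha>\<rbrakk> \<Longrightarrow> trm_equiv R (Scale \<alpha> s) (Scale \<alpha> t)"
| ctx_plus1: "\<lbrakk>trm_equiv R s t; wf_trm R u\<rbrakk> \<Longrightarrow> trm_equiv R (Plus s u) (Plus t u)"
| ctx_plus2: "\<lbrakk>trm_equiv R s t; wf_trm R u\<rbrakk> \<Longrightarrow> trm_equiv R (Plus u s) (Plus u t)"
| plus_comm: "\<lbrakk>wf_trm R s; wf_trm R t\<rbrakk> \<Longrightarrow> trm_equiv R (Plus s t) (Plus t s)"
| plus_assoc: "\<lbrakk>wf_trm R s; wf_trm R t; wf_trm R u\<rbrakk>
    \<Longrightarrow> trm_equiv R (Plus s (Plus t u)) (Plus (Plus s t) u)"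
| plus_zero: "\<lbrakk>wf_trm R s; wf_trm R t; wf_amp R \<alpha>; amp_is R \<alpha> 0\<rbrakk>
    \<Longrightarrow> trm_equiv R (Plus s (Scale \<alpha> t)) s"
| scale_one: "\<lbrakk>wf_trm R t; wf_amp R \<alpha>; amp_is R \<alpha> 1\<rbrakk> \<Longrightarrow> trm_equiv R (Scale \<alpha> t) t"
| scale_scale: "\<lbrakk>wf_trm R t; wf_amp R \<alpha>; wf_amp R \<beta>\<rbrakk>
    \<Longrightarrow> trm_equiv R (Scale \<alpha> (Scale \<beta> t)) (Scale (AMul \<alpha> \<beta>) t)"
| scale_plus: "\<lbrakk>wf_trm R s; wf_trm R t; wf_amp R \<alpha>\<rbrakk>
    \<Longrightarrow> trm_equiv R (Scale \<alpha> (Plus s t)) (Plus (Scale \<alpha> s) (Scale \<alpha> t))"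
| plus_scale: "\<lbrakk>wf_trm R t; wf_amp R \<alpha>; wf_amp R \<beta>\<rbrakk>
    \<Longrightarrow> trm_equiv R (Plus (Scale \<alpha> t) (Scale \<beta> t)) (Scale (AAdd \<alpha> \<beta>) t)"
| app_scale: "wf_trm R (App b (us @ Scale \<alpha> t # vs))
    \<Longrightarrow> trm_equiv R (App b (us @ Scale \<alpha> t # vs)) (Scale \<alpha> (App b (us @ t # vs)))"
| app_plus: "wf_trm R (App b (us @ Plus s t # vs))
    \<Longrightarrow> trm_equiv R (App b (us @ Plus s t # vs))
               (Plus (App b (us @ s # vs)) (App b (us @ t # vs)))"

text \<open>A sum of \<open>n \<ge> 1\<close> summands, nested to the right; there is no empty sum.\<close>

fun lsum :: "(('a, 'x) amp \<times> ('a, 'c, 'f, 'x, 'b) trm) list \<Rightarrow> ('a, 'c, 'f, 'x, 'b) trm" where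
  "lsum [p] = Scale (fst p) (snd p)"
| "lsum (p # q # ps) = Plus (Scale (fst p) (snd p)) (lsum (q # ps))"

definition CAN :: "('a, 'c, 'f, 'x, 'b) strs \<Rightarrow> ('a, 'c, 'f, 'x, 'b) trm set" where
  "CAN R = {lsum ps | ps. ps \<noteq> [] \<and> distinct (map snd ps) \<and>
     (\<forall>(\<alpha>, t) \<in> set ps. wf_amp R \<alpha> \<and> wf_trm R t \<and> classical t \<and> (\<exists>z. z \<noteq> 0 \<and> amp_is R \<alpha> z))}"


section \<open>Substitutions and rewrite rules\<close>

definition is_subst :: "('a, 'c, 'f, 'x, 'b) strs \<Rightarrow> ('x \<Rightarrow> ('a, 'c, 'f, 'x, 'b) trm) \<Rightarrow> bool" where
  "is_subst R \<sigma> \<longleftrightarrow> (\<forall>x. is_value R (\<sigma> x))"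

primrec numeral_trm :: "nat \<Rightarrow> ('a, 'c, 'f, 'x, 'b) trm" where
  "numeral_trm 0 = App (Con Zero) []"
| "numeral_trm (Suc n) = App (Con Succ) [numeral_trm n]"

primrec numeral_nexp :: "nat \<Rightarrow> 'x nexp" where
  "numeral_nexp 0 = NZero"
| "numeral_nexp (Suc n) = NSucc (numeral_nexp n)"

text \<open>Substituting a value \<open>v\<close> for a variable below an amplitude symbol inserts the numeral
  equivalent to \<open>v\<close>; this also covers values such as \<open>\<alpha> \<cdot> 0\<close> with \<open>\<alpha>\<close> interpreted as 1, which
  have type \<open>TNat\<close> without being numerals. For a \<open>v\<close> that denotes no natural number, an
  unspecified numeral is inserted, so that substitution always yields terms.\<close>

definition nat_val :: "('a, 'c, 'f, 'x, 'b) strs \<Rightarrow> ('a, 'c, 'f, 'x, 'b) trm \<Rightarrow> nat" where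
  "nat_val R v = (THE n. trm_equiv R v (numeral_trm n))"

primrec nsubst :: "('a, 'c, 'f, 'x, 'b) strs \<Rightarrow>
    ('x \<Rightarrow> ('a, 'c, 'f, 'x, 'b) trm) \<Rightarrow> 'x nexp \<Rightarrow> 'x nexp" where
  "nsubst R \<sigma> (NVar x) = numeral_nexp (nat_val R (\<sigma> x))"
| "nsubst R \<sigma> NZero = NZero"
| "nsubst R \<sigma> (NSucc n) = NSucc (nsubst R \<sigma> n)"

primrec asubst :: "('a, 'c, 'f, 'x, 'b) strs \<Rightarrow>
    ('x \<Rightarrow> ('a, 'c, 'f, 'x, 'b) trm) \<Rightarrow> ('a, 'x) amp \<Rightarrow> ('a, 'x) amp" where
  "asubst R \<sigma> (Amp a ns) = Amp a (map (nsubst R \<sigma>) ns)"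
| "asubst R \<sigma> (AMul \<alpha> \<beta>) = AMul (asubst R \<sigma> \<alpha>) (asubst R \<sigma> \<beta>)"
| "asubst R \<sigma> (AAdd \<alpha> \<beta>) = AAdd (asubst R \<sigma> \<alpha>) (asubst R \<sigma> \<beta>)"

primrec tsubst :: "('a, 'c, 'f, 'x, 'b) strs \<Rightarrow>
    ('x \<Rightarrow> ('a, 'c, 'f, 'x, 'b) trm) \<Rightarrow> ('a, 'c, 'f, 'x, 'b) trm \<Rightarrow> ('a, 'c, 'f, 'x, 'b) trm" where
  "tsubst R \<sigma> (Var x) = \<sigma> x"
| "tsubst R \<sigma> (App b ts) = App b (map (tsubst R \<sigma>) ts)"
| "tsubst R \<sigma> (Scale \<alpha> t) = Scale (asubst R \<sigma> \<alpha>) (tsubst R \<sigma> t)"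
| "tsubst R \<sigma> (Plus s t) = Plus (tsubst R \<sigma> s) (tsubst R \<sigma> t)"

definition is_rule :: "('a, 'c, 'f, 'x, 'b) strs \<Rightarrow>
    ('a, 'c, 'f, 'x, 'b) trm \<Rightarrow> ('a, 'c, 'f, 'x, 'b) trm \<Rightarrow> bool" where
  "is_rule R l r \<longleftrightarrow>
     (\<exists>f ps. l = App (Fun f) ps \<and> (\<forall>p \<in> set ps. classical p \<and> no_funs p)) \<and>
     wf_trm R l \<and> wf_trm R r \<and> tvars r \<subseteq> tvars l"

inductive linear_trm :: "('a, 'c, 'f, 'x, 'b) trm \<Rightarrow> bool" where
  linear_var: "linear_trm (Var x)"
| linear_app: "\<lbrakk>\<forall>t \<in> set ts. linear_trm t; sorted_wrt (\<lambda>s t. tvars s \<inter> tvars t = {}) ts\<rbrakk>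
    \<Longrightarrow> linear_trm (App b ts)"

fun subterms :: "('a, 'c, 'f, 'x, 'b) trm \<Rightarrow> ('a, 'c, 'f, 'x, 'b) trm set" where
  "subterms (Var x) = {Var x}"
| "subterms (App b ts) = insert (App b ts) (\<Union>t \<in> set ts. subterms t)"
| "subterms (Scale \<alpha> t) = insert (Scale \<alpha> t) (subterms t)"
| "subterms (Plus s t) = insert (Plus s t) (subterms s \<union> subterms t)"

text \<open>The two independent, arbitrary term substitutions account for renaming the rules apart.\<close>

definition non_overlapping :: "('a, 'c, 'f, 'x, 'b) strs \<Rightarrow> bool" where
  "non_overlapping R \<longleftrightarrow>
     (\<forall>(l, r) \<in> rules R. \<forall>(l', r') \<in> rules R. \<forall>u \<in> subterms l'.
        (\<nexists>x. u = Var x) \<and> (u = l' \<longrightarrow> (l, r) \<noteq> (l', r')) \<longrightarrow>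
        (\<nexists>\<sigma> \<tau>. tsubst R \<sigma> l = tsubst R \<tau> u))"

definition is_strs :: "('a, 'c, 'f, 'x, 'b) strs \<Rightarrow> bool" where
  "is_strs R \<longleftrightarrow> main_sym R \<in> fun_syms R \<and>
     (\<forall>(l, r) \<in> rules R. is_rule R l r \<and> linear_trm l) \<and> non_overlapping R"


section \<open>Reduction\<close>

datatype ('a, 'c, 'f, 'x, 'b) ectx =
    EHole
  | EApp "('c, 'f, 'b) sym" "('a, 'c, 'f, 'x, 'b) trm list" "('a, 'c, 'f, 'x, 'b) ectx"
      "('a, 'c, 'f, 'x, 'b) trm list"

primrec is_ectx :: "('a, 'c, 'f, 'x, 'b) strs \<Rightarrow> ('a, 'c, 'f, 'x, 'b) ectx \<Rightarrow> bool" where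
  "is_ectx R EHole \<longleftrightarrow> True"
| "is_ectx R (EApp b vs E ts) \<longleftrightarrow>
     sym_in R b \<and> length vs + 1 + length ts = sym_ar R b \<and>
     (\<forall>v \<in> set vs. is_value R v) \<and> is_ectx R E \<and> (\<forall>t \<in> set ts. wf_trm R t)"

primrec fill :: "('a, 'c, 'f, 'x, 'b) ectx \<Rightarrow> ('a, 'c, 'f, 'x, 'b) trm \<Rightarrow> ('a, 'c, 'f, 'x, 'b) trm" where
  "fill EHole t = t"
| "fill (EApp b vs E ts) t = App b (vs @ fill E t # ts)"

text \<open>The reduction relation refers to its own normal forms negatively. \<open>red_with R N\<close> is
  inductively defined with a parameter \<open>N\<close> in place of the set of normal forms, and \<open>red R\<close>
  is the unique relation for which \<open>N\<close> is its own set of normal forms (see \<open>red_unfold\<close> below).\<close>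

inductive red_with :: "('a, 'c, 'f, 'x, 'b) strs \<Rightarrow> ('a, 'c, 'f, 'x, 'b) trm set \<Rightarrow>
    ('a, 'c, 'f, 'x, 'b) trm \<Rightarrow> ('a, 'c, 'f, 'x, 'b) trm \<Rightarrow> bool" for R N where
  red_C: "\<lbrakk>(l, r) \<in> rules R; is_subst R \<sigma>; is_ectx R E; classical (fill E (tsubst R \<sigma> l));
      fill E (tsubst R \<sigma> l) \<in> ground_terms R; fill E (tsubst R \<sigma> r) \<in> ground_terms R\<rbrakk>
    \<Longrightarrow> red_with R N (fill E (tsubst R \<sigma> l)) (fill E (tsubst R \<sigma> r))"
| red_E: "\<lbrakk>trm_equiv R s s'; red_with R N s' t'; trm_equiv R t' t;
      s \<in> ground_terms R; t \<in> ground_terms R\<rbrakk>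
    \<Longrightarrow> red_with R N s t"
| red_Q: "\<lbrakk>ss \<noteq> []; length \<alpha>s = length ss; length ts = length ss;
      lsum (zip \<alpha>s ss) \<in> CAN R;
      \<forall>i < length ss. (ss ! i \<in> N \<and> ts ! i = ss ! i) \<or> red_with R N (ss ! i) (ts ! i);
      \<exists>i < length ss. red_with R N (ss ! i) (ts ! i);
      lsum (zip \<alpha>s ss) \<in> ground_terms R; lsum (zip \<alpha>s ts) \<in> ground_terms R\<rbrakk>
    \<Longrightarrow> red_with R N (lsum (zip \<alpha>s ss)) (lsum (zip \<alpha>s ts))"

definition NF_of :: "('a, 'c, 'f, 'x, 'b) strs \<Rightarrow>
    (('a, 'c, 'f, 'x, 'b) trm \<Rightarrow> ('a, 'c, 'f, 'x, 'b) trm \<Rightarrow> bool) \<Rightarrow> ('a, 'c, 'f, 'x, 'b) trm set" where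
  "NF_of R rel = {s \<in> ground_terms R. \<nexists>t. rel s t}"

definition red :: "('a, 'c, 'f, 'x, 'b) strs \<Rightarrow>
    ('a, 'c, 'f, 'x, 'b) trm \<Rightarrow> ('a, 'c, 'f, 'x, 'b) trm \<Rightarrow> bool" where
  "red R = (THE rel. rel = red_with R (NF_of R rel))"

definition NF :: "('a, 'c, 'f, 'x, 'b) strs \<Rightarrow> ('a, 'c, 'f, 'x, 'b) trm set" where
  "NF R = NF_of R (red R)"


text \<open>The equation defining \<open>red\<close> has exactly one solution: in the rule \<open>red_Q\<close> the set \<open>N\<close> is
  only used for classical terms, and whether these are reducible does not depend on \<open>N\<close>. This is
  because equivalent terms denote the same formal linear combination of classical terms.\<close>

primrec vec :: "('a, 'c, 'f, 'x, 'b) strs \<Rightarrow> ('a, 'c, 'f, 'x, 'b) trm \<Rightarrow>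
    ('a, 'c, 'f, 'x, 'b) trm \<Rightarrow> complex" where
  "vec R (Var x) = (\<lambda>u. if u = Var x then 1 else 0)"
| "vec R (App b ts) = (\<lambda>u.
     case u of
       App c us \<Rightarrow>
         if c = b \<and> length us = length ts
         then prod_list (map2 (\<lambda>f u. f u) (map (vec R) ts) us) else 0
     | _ \<Rightarrow> 0)"
| "vec R (Scale \<alpha> t) = (\<lambda>u. aval R \<alpha> * vec R t u)"
| "vec R (Plus s t) = (\<lambda>u. vec R s u + vec R t u)"

lemma vec_App:
  "vec R (App b ts) u =
     (case u of
        App c us \<Rightarrow>
          if c = b \<and> length us = length ts then prod_list (map2 (vec R) ts us) else 0
      | _ \<Rightarrow> 0)"
proof -
  have "map2 (\<lambda>f u. f u) (map (vec R) ts) us = map2 (vec R) ts us" for us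
    by (induction ts us rule: list_induct2') auto
  then show ?thesis by (simp split: trm.splits)
qed

declare vec.simps(2) [simp del]

lemma vec_hole:
  "vec R (App b (us @ s # vs)) w =
     (case w of
        App c ws \<Rightarrow>
          if c = b \<and> length ws = Suc (length us + length vs)
          then prod_list (map2 (vec R) us (take (length us) ws)) * vec R s (ws ! length us) *
            prod_list (map2 (vec R) vs (drop (Suc (length us)) ws))
          else 0
      | _ \<Rightarrow> 0)"
proof (cases w)
  case (App c ws)
  show ?thesis
  proof (cases "length ws = Suc (length us + length vs)")
    case True
    then have "ws = take (length us) ws @ ws ! length us # drop (Suc (length us)) ws"
      by (simp add: id_take_nth_drop)
    then obtain ws1 w' ws2 where ws: "ws = ws1 @ w' # ws2" "length ws1 = length us"
      using True by (metis length_take less_Suc_eq_le le_add1 min.absorb2 less_imp_le)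
    then have "ws ! length us = w'" by (metis nth_append_length)
    with ws True App show ?thesis by (simp add: vec_App mult.assoc)
  qed (use App in \<open>simp add: vec_App\<close>)
qed (simp_all add: vec_App)

lemma trm_equiv_vec: "trm_equiv R s t \<Longrightarrow> vec R s = vec R t"
proof (induction rule: trm_equiv.induct)
qed (auto simp: fun_eq_iff vec_hole amp_is_def aval_def algebra_simps
    split: trm.splits)

lemma vec_classical: "classical t \<Longrightarrow> vec R t u = (if u = t then 1 else 0)"
proof (induction t arbitrary: u)
  case (App b ts)
  show ?case
  proof (cases u)
    case [simp]: (App c us)
    have "prod_list (map2 (vec R) ts us) = (if us = ts then 1 else 0)"
      if "length us = length ts" for us
      using that App.IH App.prems
      by (induction us ts rule: list_induct2) auto
    then show ?thesis by (auto simp: vec_App)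
  qed (auto simp: vec_App)
qed auto

lemma vec_lsum:
  "ps \<noteq> [] \<Longrightarrow> vec R (lsum ps) u = (\<Sum>(\<alpha>, t) \<leftarrow> ps. aval R \<alpha> * vec R t u)"
  by (induction ps rule: lsum.induct) (auto simp: case_prod_unfold)

lemma lsum_inject: "\<lbrakk>lsum ps = lsum qs; ps \<noteq> []; qs \<noteq> []\<rbrakk> \<Longrightarrow> ps = qs"
proof (induction ps arbitrary: qs rule: lsum.induct)
  case (1 p)
  then show ?case by (cases qs rule: lsum.cases) (auto intro: prod_eqI)
next
  case (2 p q ps)
  then show ?case by (cases qs rule: lsum.cases) (auto intro: prod_eqI)
qed auto

lemma CAN_lsumD:
  assumes "lsum ps \<in> CAN R" "ps \<noteq> []"
  shows "distinct (map snd ps)" "\<And>\<alpha> t. (\<alpha>, t) \<in> set ps \<Longrightarrow> classical t \<and> aval R \<alpha> \<noteq> 0"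
  using assms by (auto simp: CAN_def amp_is_def aval_def dest!: lsum_inject)

lemma vec_CAN:
  assumes "lsum ps \<in> CAN R" "(\<alpha>, t) \<in> set ps"
  shows "vec R (lsum ps) t = aval R \<alpha>"
proof -
  have ne: "ps \<noteq> []" using assms(2) by auto
  note can = CAN_lsumD[OF assms(1) ne]
  have "(\<Sum>(\<beta>, s) \<leftarrow> qs. aval R \<beta> * vec R s t) = (if t \<in> snd ` set qs then aval R \<alpha> else 0)"
    if "set qs \<subseteq> set ps" "distinct (map snd qs)" for qs
    using that
  proof (induction qs)
    case (Cons q qs)
    obtain \<beta> s where q: "q = (\<beta>, s)" by force
    have "vec R s t = (if t = s then 1 else 0)"
      using can(2)[of \<beta> s] Cons.prems q by (simp add: vec_classical)
    moreover have "\<beta> = \<alpha>" if "t = s"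
      using that can(1) Cons.prems(1) q assms(2) inj_onD[of snd "set ps" "(\<beta>, s)" "(\<alpha>, t)"]
      by (auto simp: distinct_map)
    ultimately show ?case using Cons q by auto
  qed simp
  from this[of ps] show ?thesis using assms(2) can(1) ne by (force simp: vec_lsum)
qed

lemma red_with_classical:
  assumes "red_with R N s t" "classical c" "c \<in> ground_terms R" "trm_equiv R s c"
  shows "\<exists>t'. red_with R M c t'"
  using assms
proof (induction rule: red_with.induct)
  case (red_C l r \<sigma> E)
  have "vec R (fill E (tsubst R \<sigma> l)) c = vec R c c"
    using trm_equiv_vec[OF red_C.prems(3)] by simp
  then have "c = fill E (tsubst R \<sigma> l)"
    using red_C by (simp add: vec_classical split: if_splits)
  then show ?case using red_with.red_C[OF red_C.hyps] by blast
next
  case (red_E s s' t' t)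
  then show ?case by (meson trm_equiv.equiv_sym trm_equiv.equiv_trans)
next
  case (red_Q ss \<alpha>s ts)
  obtain i where i: "i < length ss"
    and IH: "classical c \<Longrightarrow> c \<in> ground_terms R \<Longrightarrow> trm_equiv R (ss ! i) c \<Longrightarrow> \<exists>t'. red_with R M c t'"
    using red_Q.IH by blast
  have mem: "(\<alpha>s ! i, ss ! i) \<in> set (zip \<alpha>s ss)"
    using i red_Q.hyps(2) by (auto simp: set_zip)
  have "vec R (lsum (zip \<alpha>s ss)) (ss ! i) = aval R (\<alpha>s ! i)"
    using vec_CAN[OF red_Q.hyps(4) mem] .
  moreover have "aval R (\<alpha>s ! i) \<noteq> 0"
    using CAN_lsumD(2)[OF red_Q.hyps(4) _ mem] mem by fastforce
  ultimately have "vec R c (ss ! i) \<noteq> 0" using trm_equiv_vec[OF red_Q.prems(3)] by simp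
  then have "ss ! i = c" using red_Q.prems(1) by (simp add: vec_classical split: if_splits)
  moreover have "trm_equiv R c c"
    using red_Q.prems(2) by (simp add: ground_terms_def trm_equiv.equiv_refl)
  ultimately show ?case using IH red_Q.prems by simp
qed

lemma red_with_mono:
  assumes "red_with R N s t" "\<And>c. classical c \<Longrightarrow> c \<in> N \<Longrightarrow> c \<in> M"
  shows "red_with R M s t"
  using assms(1)
proof (induction rule: red_with.induct)
  case (red_Q ss \<alpha>s ts)
  have "classical (ss ! i)" if "i < length ss" for i
  proof -
    have "(\<alpha>s ! i, ss ! i) \<in> set (zip \<alpha>s ss)"
      using that red_Q.hyps(2) by (auto simp: set_zip)
    then show ?thesis using CAN_lsumD(2)[OF red_Q.hyps(4)] by fastforce
  qed
  then show ?case
    by (intro red_with.red_Q) (use red_Q assms(2) in blast)+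
qed (blast intro: red_with.intros)+

lemma classical_NF_of_red_with:
  assumes "classical c"
  shows "c \<in> NF_of R (red_with R N) \<longleftrightarrow> c \<in> NF_of R (red_with R M)"
proof -
  have "\<exists>t. red_with R M' c t" if "red_with R N' c t" "c \<in> ground_terms R" for t N' M'
    using red_with_classical[OF that(1) assms that(2)] that(2)
    by (simp add: ground_terms_def trm_equiv.equiv_refl)
  then show ?thesis unfolding NF_of_def by blast
qed

lemma red_ex1: "\<exists>!rel. rel = red_with R (NF_of R rel)"
proof -
  have eq: "red_with R (NF_of R (red_with R N)) = red_with R (NF_of R (red_with R M))" for N M
    using red_with_mono classical_NF_of_red_with by (intro ext iffI) blast+
  show ?thesis
  proof (rule ex1I[of _ "red_with R (NF_of R (red_with R {}))"])
    show "red_with R (NF_of R (red_with R {})) =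
        red_with R (NF_of R (red_with R (NF_of R (red_with R {}))))" by (rule eq)
    show "rel = red_with R (NF_of R (red_with R {}))" if "rel = red_with R (NF_of R rel)" for rel
      using that eq by metis
  qed
qed

lemma red_unfold: "red R = red_with R (NF R)"
  unfolding NF_def red_def by (rule theI'[OF red_ex1])


section \<open>Types and orthogonality\<close>

inductive quantum :: "('a, 'c, 'f, 'x, 'b) strs \<Rightarrow> 'b ty \<Rightarrow> bool" for R where
  quantum_qbit: "quantum R TQbit"
| quantum_con: "\<lbrakk>sym_in R (Con c); sym_sig R (Con c) = (Ts, T); U \<in> set Ts; quantum R U\<rbrakk>
    \<Longrightarrow> quantum R T"

type_synonym ('x, 'b) ctx = "'x \<Rightarrow> 'b ty option"

text \<open>In what follows \<open>V v T\<close> stands for the judgment that \<open>v\<close> has type \<open>T\<close> in the empty contexts.\<close>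

definition sub0 :: "('a, 'c, 'f, 'x, 'b) strs \<Rightarrow> (('a, 'c, 'f, 'x, 'b) trm \<Rightarrow> 'b ty \<Rightarrow> bool) \<Rightarrow>
    ('x, 'b) ctx \<Rightarrow> ('x \<Rightarrow> ('a, 'c, 'f, 'x, 'b) trm) set" where
  "sub0 R V \<Theta> = {\<sigma>. is_subst R \<sigma> \<and> (\<forall>x T. \<Theta> x = Some T \<longrightarrow> V (\<sigma> x) T)}"

text \<open>Multi-hole contexts over classical terms. The holes are numbered, each number below \<open>n\<close>
  occurring exactly once in an \<open>n\<close>-hole context, in any left-to-right order.\<close>

datatype ('c, 'f, 'x, 'b) mctx =
    MHole nat | MVar 'x | MApp "('c, 'f, 'b) sym" "('c, 'f, 'x, 'b) mctx list"

fun holes :: "('c, 'f, 'x, 'b) mctx \<Rightarrow> nat list" where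
  "holes (MHole i) = [i]"
| "holes (MVar x) = []"
| "holes (MApp b Cs) = concat (map holes Cs)"

fun mfill :: "('c, 'f, 'x, 'b) mctx \<Rightarrow> ('a, 'c, 'f, 'x, 'b) trm list \<Rightarrow> ('a, 'c, 'f, 'x, 'b) trm" where
  "mfill (MHole i) ts = ts ! i"
| "mfill (MVar x) ts = Var x"
| "mfill (MApp b Cs) ts = App b (map (\<lambda>C. mfill C ts) Cs)"

definition ket_differ :: "('a, 'c, 'f, 'x, 'b) trm \<Rightarrow> ('a, 'c, 'f, 'x, 'b) trm \<Rightarrow> bool" where
  "ket_differ s t \<longleftrightarrow>
     (\<exists>n C q ss ts. distinct (holes C) \<and> set (holes C) = {..<Suc n} \<and>
        length ss = n \<and> length ts = n \<and>
        s = mfill C (App (Con (Ket q)) [] # ss) \<and> t = mfill C (App (Con (Ket (\<not> q))) [] # ts))"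

definition delta :: "('a, 'c, 'f, 'x, 'b) trm \<Rightarrow> ('a, 'c, 'f, 'x, 'b) trm \<Rightarrow> complex option" where
  "delta s t = (if s = t then Some 1 else if ket_differ s t then Some 0 else None)"

text \<open>Reaching a sum in \<open>CAN\<close> is understood modulo \<open>trm_equiv\<close>: a canonical form of some reduct is
  reached. Reduction itself is closed under \<open>trm_equiv\<close>, but the empty reduction sequence is not, and
  a classical value, which is a normal form, is never literally a sum of scaled terms.\<close>

definition reaches :: "('a, 'c, 'f, 'x, 'b) strs \<Rightarrow> ('a, 'c, 'f, 'x, 'b) trm \<Rightarrow>
    (('a, 'x) amp \<times> ('a, 'c, 'f, 'x, 'b) trm) list \<Rightarrow> bool" where
  "reaches R s ps \<longleftrightarrow> ps \<noteq> [] \<and> (\<forall>(\<alpha>, v) \<in> set ps. classical v \<and> is_value R v) \<and>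
     lsum ps \<in> CAN R \<inter> ground_terms R \<and> (\<exists>u. (red R)\<^sup>*\<^sup>* s u \<and> trm_equiv R u (lsum ps))"

definition orth_with :: "('a, 'c, 'f, 'x, 'b) strs \<Rightarrow> (('a, 'c, 'f, 'x, 'b) trm \<Rightarrow> 'b ty \<Rightarrow> bool) \<Rightarrow>
    ('x, 'b) ctx \<Rightarrow> ('x, 'b) ctx \<Rightarrow> ('a, 'c, 'f, 'x, 'b) trm \<Rightarrow> ('a, 'c, 'f, 'x, 'b) trm \<Rightarrow> bool" where
  "orth_with R V \<Gamma> \<Delta> s t \<longleftrightarrow>
     (\<forall>\<sigma> \<in> sub0 R V (\<Gamma> ++ \<Delta>). \<exists>ps qs.
        reaches R (tsubst R \<sigma> s) ps \<and> reaches R (tsubst R \<sigma> t) qs \<and>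
        (\<forall>(\<alpha>, v) \<in> set ps. \<forall>(\<beta>, w) \<in> set qs. delta v w \<noteq> None) \<and>
        (\<Sum>(\<alpha>, v) \<leftarrow> ps. \<Sum>(\<beta>, w) \<leftarrow> qs. aval R \<alpha> * cnj (aval R \<beta>) * the (delta v w)) = 0)"

primrec nexp_trm :: "'x nexp \<Rightarrow> ('a, 'c, 'f, 'x, 'b) trm" where
  "nexp_trm (NVar x) = Var x"
| "nexp_trm NZero = App (Con Zero) []"
| "nexp_trm (NSucc n) = App (Con Succ) [nexp_trm n]"

text \<open>Typing refers to itself negatively, through the well-typed substitutions in the rule \<open>sup\<close>.
  As for reduction, the inductive definition has a parameter \<open>V\<close> for these occurrences, and
  \<open>typing\<close> is the unique relation for which \<open>V\<close> is its own restriction to the empty contexts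
  (see \<open>typing_unfold\<close> below). In the rule \<open>sup\<close>, orthogonality is only used for terms that have
  type \<open>T\<close> in the given contexts.\<close>

inductive typ_with :: "('a, 'c, 'f, 'x, 'b) strs \<Rightarrow> (('a, 'c, 'f, 'x, 'b) trm \<Rightarrow> 'b ty \<Rightarrow> bool) \<Rightarrow>
    ('x, 'b) ctx \<Rightarrow> ('x, 'b) ctx \<Rightarrow> ('a, 'c, 'f, 'x, 'b) trm \<Rightarrow> 'b ty \<Rightarrow> bool"
  and amp_with :: "('a, 'c, 'f, 'x, 'b) strs \<Rightarrow> (('a, 'c, 'f, 'x, 'b) trm \<Rightarrow> 'b ty \<Rightarrow> bool) \<Rightarrow>
    ('x, 'b) ctx \<Rightarrow> ('a, 'x) amp \<Rightarrow> bool"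
  for R V where
  var_classical: "\<lbrakk>\<Gamma> x = Some T; \<not> quantum R T\<rbrakk> \<Longrightarrow> typ_with R V \<Gamma> Map.empty (Var x) T"
| var_quantum: "\<lbrakk>x \<notin> dom \<Gamma>; quantum R T\<rbrakk> \<Longrightarrow> typ_with R V \<Gamma> [x \<mapsto> T] (Var x) T"
| conv: "\<lbrakk>typ_with R V \<Gamma> \<Delta> s T; trm_equiv R s t; tvars t \<subseteq> dom \<Gamma> \<union> dom \<Delta>\<rbrakk>
    \<Longrightarrow> typ_with R V \<Gamma> \<Delta> t T"
| symb: "\<lbrakk>sym_in R b; sym_sig R b = (Ts, T); length ts = length Ts; length \<Delta>s = length Ts;
      \<forall>i < length Ts. typ_with R V \<Gamma> (\<Delta>s ! i) (ts ! i) (Ts ! i);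
      sorted_wrt (\<lambda>\<Delta> \<Delta>'. dom \<Delta> \<inter> dom \<Delta>' = {}) \<Delta>s\<rbrakk>
    \<Longrightarrow> typ_with R V \<Gamma> (foldr (++) \<Delta>s Map.empty) (App b ts) T"
| sup: "\<lbrakk>quantum R T; ts \<noteq> []; length \<alpha>s = length ts;
      \<forall>i < length ts. typ_with R V \<Gamma> \<Delta> (ts ! i) T;
      \<forall>i < length ts. amp_with R V \<Gamma> (\<alpha>s ! i);
      \<forall>\<sigma> \<in> sub0 R V \<Gamma>. (\<Sum>i < length ts. (cmod (aval R (asubst R \<sigma> (\<alpha>s ! i))))\<^sup>2) = 1;
      \<forall>i < length ts. \<forall>j < length ts. i \<noteq> j \<longrightarrow> orth_with R V \<Gamma> \<Delta> (ts ! i) (ts ! j)\<rbrakk>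
    \<Longrightarrow> typ_with R V \<Gamma> \<Delta> (lsum (zip \<alpha>s ts)) T"
| amp: "\<lbrakk>a \<in> amp_syms R; length ns = amp_ar R a;
      \<forall>i < length ns. typ_with R V \<Gamma> Map.empty (nexp_trm (ns ! i)) TNat\<rbrakk>
    \<Longrightarrow> amp_with R V \<Gamma> (Amp a ns)"
| amp_mul: "\<lbrakk>amp_with R V \<Gamma> \<alpha>; amp_with R V \<Gamma> \<beta>\<rbrakk> \<Longrightarrow> amp_with R V \<Gamma> (AMul \<alpha> \<beta>)"
| amp_add: "\<lbrakk>amp_with R V \<Gamma> \<alpha>; amp_with R V \<Gamma> \<beta>\<rbrakk> \<Longrightarrow> amp_with R V \<Gamma> (AAdd \<alpha> \<beta>)"

definition typing :: "('a, 'c, 'f, 'x, 'b) strs \<Rightarrow> ('x, 'b) ctx \<Rightarrow> ('x, 'b) ctx \<Rightarrow>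
    ('a, 'c, 'f, 'x, 'b) trm \<Rightarrow> 'b ty \<Rightarrow> bool" where
  "typing R = (THE j. j = typ_with R (j Map.empty Map.empty))"

definition closed_typing :: "('a, 'c, 'f, 'x, 'b) strs \<Rightarrow>
    ('a, 'c, 'f, 'x, 'b) trm \<Rightarrow> 'b ty \<Rightarrow> bool" where
  "closed_typing R = typing R Map.empty Map.empty"

lemma typ_with_closed_cong:
  "typ_with R V \<Gamma> \<Delta> t T \<Longrightarrow> \<Gamma> = Map.empty \<Longrightarrow> \<Delta> = Map.empty \<Longrightarrow> typ_with R W \<Gamma> \<Delta> t T"
  "amp_with R V \<Gamma> \<alpha> \<Longrightarrow> \<Gamma> = Map.empty \<Longrightarrow> amp_with R W \<Gamma> \<alpha>"
proof (induction rule: typ_with_amp_with.inducts)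
  case (symb b Ts T ts \<Delta>s \<Gamma>)
  have "\<Delta> = Map.empty" if "\<Delta> \<in> set \<Delta>s" for \<Delta>
  proof -
    have "dom \<Delta> \<subseteq> dom (foldr (++) \<Delta>s Map.empty)"
      using that by (induction \<Delta>s) auto
    then show ?thesis using symb.prems by simp
  qed
  then show ?case
    using symb by (intro typ_with_amp_with.symb) auto
next
  case (sup T ts \<alpha>s \<Gamma> \<Delta>)
  have "sub0 R V Map.empty = sub0 R W Map.empty" by (simp add: sub0_def)
  with sup show ?case
    by (intro typ_with_amp_with.sup) (auto simp: orth_with_def)
qed (auto intro: typ_with_amp_with.intros)

lemma typing_ex1: "\<exists>!j. j = typ_with R (j Map.empty Map.empty)"
proof -
  have eq: "typ_with R V Map.empty Map.empty = typ_with R W Map.empty Map.empty" for V W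
    using typ_with_closed_cong(1) by (intro ext iffI) blast+
  show ?thesis
  proof (rule ex1I[of _ "typ_with R (typ_with R (\<lambda>_ _. False) Map.empty Map.empty)"])
    show "typ_with R (typ_with R (\<lambda>_ _. False) Map.empty Map.empty) =
      typ_with R (typ_with R (typ_with R (\<lambda>_ _. False) Map.empty Map.empty) Map.empty Map.empty)"
      by (subst eq) (rule refl)
    show "j = typ_with R (typ_with R (\<lambda>_ _. False) Map.empty Map.empty)"
      if "j = typ_with R (j Map.empty Map.empty)" for j
      using that eq by metis
  qed
qed

lemma typing_unfold: "typing R = typ_with R (closed_typing R)"
  unfolding closed_typing_def typing_def by (rule theI'[OF typing_ex1])


definition orth :: "('a, 'c, 'f, 'x, 'b) strs \<Rightarrow>
    ('a, 'c, 'f, 'x, 'b) trm \<Rightarrow> ('a, 'c, 'f, 'x, 'b) trm \<Rightarrow> bool" where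
  "orth R = orth_with R (closed_typing R) Map.empty Map.empty"


section \<open>Total quantum term rewrite systems\<close>

definition inputs :: "('a, 'c, 'f, 'x, 'b) strs \<Rightarrow> ('c, 'f, 'b) sym \<Rightarrow>
    ('a, 'c, 'f, 'x, 'b) trm list set" where
  "inputs R b = {vs. list_all2 (\<lambda>v T. is_value R v \<and> closed_typing R v T) vs (fst (sym_sig R b))}"

definition isometry :: "('a, 'c, 'f, 'x, 'b) strs \<Rightarrow> 'f \<Rightarrow> bool" where
  "isometry R f \<longleftrightarrow>
     (\<forall>vs \<in> inputs R (Fun f). \<forall>ws \<in> inputs R (Fun f).
        (\<exists>i < length vs. orth R (vs ! i) (ws ! i)) \<longrightarrow> orth R (App (Fun f) vs) (App (Fun f) ws))"

definition qtrs :: "('a, 'c, 'f, 'x, 'b) strs \<Rightarrow> bool" where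
  "qtrs R \<longleftrightarrow> is_strs R \<and> (\<forall>f \<in> fun_syms R. isometry R f) \<and>
     (\<forall>(l, r) \<in> rules R. \<forall>\<Gamma> \<Delta> T. typing R \<Gamma> \<Delta> l T \<longrightarrow> typing R \<Gamma> \<Delta> r T)"

definition total_qtrs :: "('a, 'c, 'f, 'x, 'b) strs \<Rightarrow> bool" where
  "total_qtrs R \<longleftrightarrow>
     (\<forall>f \<in> fun_syms R. \<forall>vs \<in> inputs R (Fun f).
        \<exists>\<sigma> l r. is_subst R \<sigma> \<and> (l, r) \<in> rules R \<and> tsubst R \<sigma> l = App (Fun f) vs)"

end

theory Submission
  imports Defs
begin

text \<open>Equivalent terms have the same coefficient vector \<open>vec\<close>. A reducible term has a classical
  term containing a function symbol in the support of its vector, and a value has none, so terms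
  equivalent to values are irreducible. Conversely, every classical term in the support of a closed
  typed term is built from well-typed applications only, hence is a value or, by totality, contains
  a redex in evaluation position. A closed typed term is equivalent to a classical term or to a sum
  of scaled classical terms; a shortest such sum is canonical, unless it is a single summand with
  coefficient 0, in which case it is equivalent to the value \<open>0 \<cdot> ()\<close>.\<close>

section \<open>Sums modulo equivalence\<close>

lemma trm_equiv_wf: "trm_equiv R s t \<Longrightarrow> wf_trm R s \<and> wf_trm R t"
  by (induction rule: trm_equiv.induct) auto

declare equiv_trans [trans]

lemma equiv_plus:
  "\<lbrakk>trm_equiv R s s'; trm_equiv R t t'\<rbrakk> \<Longrightarrow> trm_equiv R (Plus s t) (Plus s' t')"
  using equiv_trans[OF ctx_plus1 ctx_plus2] trm_equiv_wf by blast

lemma wf_lsum: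
  "ps \<noteq> [] \<Longrightarrow> wf_trm R (lsum ps) \<longleftrightarrow> (\<forall>(\<alpha>, t) \<in> set ps. wf_amp R \<alpha> \<and> wf_trm R t)"
  by (induction ps rule: lsum.induct) (auto simp: case_prod_unfold)

lemma tvars_lsum:
  "ps \<noteq> [] \<Longrightarrow> tvars (lsum ps) = (\<Union>(\<alpha>, t) \<in> set ps. avars \<alpha> \<union> tvars t)"
  by (induction ps rule: lsum.induct) (auto simp: case_prod_unfold)

text \<open>Sums nest to the right, so each summand of \<open>ps\<close> costs one reassociation.
  Both lists must be nonempty because \<open>lsum\<close> has no empty sum.\<close>

lemma lsum_append:
  assumes "ps \<noteq> []" "qs \<noteq> []" "wf_trm R (lsum ps)" "wf_trm R (lsum qs)"
  shows "trm_equiv R (lsum (ps @ qs)) (Plus (lsum ps) (lsum qs))"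
  using assms
proof (induction ps rule: lsum.induct)
  case (1 p)
  then obtain q qs' where "qs = q # qs'" by (cases qs) auto
  with 1 show ?case by (simp add: equiv_refl)
next
  case (2 p q ps)
  then have "trm_equiv R (Plus (Scale (fst p) (snd p)) (lsum ((q # ps) @ qs)))
      (Plus (Scale (fst p) (snd p)) (Plus (lsum (q # ps)) (lsum qs)))"
    by (intro ctx_plus2) auto
  also have "trm_equiv R \<dots> (Plus (Plus (Scale (fst p) (snd p)) (lsum (q # ps))) (lsum qs))"
    using 2 by (intro plus_assoc) auto
  finally show ?case by simp
qed auto

lemma lsum_swap:
  assumes "ps \<noteq> []" "qs \<noteq> []" "wf_trm R (lsum ps)" "wf_trm R (lsum qs)"
  shows "trm_equiv R (lsum (ps @ qs)) (lsum (qs @ ps))"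
  using equiv_trans[OF equiv_trans[OF lsum_append[OF assms] plus_comm[OF assms(3,4)]]
    equiv_sym[OF lsum_append[OF assms(2,1,4,3)]]] .

text \<open>Swapping \<open>ps\<close> with \<open>[p]\<close> suffices, the tail \<open>qs\<close>
  being carried along by congruence. The case distinctions keep empty lists away from
  \<open>lsum\<close>.\<close>

lemma lsum_to_front:
  assumes "wf_trm R (lsum (ps @ p # qs))"
  shows "trm_equiv R (lsum (ps @ p # qs)) (lsum (p # ps @ qs))"
proof (cases "ps = []")
  case True
  with assms show ?thesis by (simp add: equiv_refl)
next
  case ps: False
  have wf: "wf_trm R (lsum ps)" "wf_trm R (lsum [p])" "wf_trm R (lsum (ps @ [p]))"
    using assms ps by (auto simp: wf_lsum simp del: lsum.simps)
  have swap: "trm_equiv R (lsum (ps @ [p])) (lsum ([p] @ ps))"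
    using lsum_swap[OF ps _ wf(1,2)] by simp
  show ?thesis
  proof (cases "qs = []")
    case True
    with swap show ?thesis by simp
  next
    case qs: False
    have wq: "wf_trm R (lsum qs)"
      using assms qs by (auto simp: wf_lsum simp del: lsum.simps)
    have "trm_equiv R (lsum ((ps @ [p]) @ qs)) (Plus (lsum (ps @ [p])) (lsum qs))"
      by (rule lsum_append) (use qs wf wq in auto)
    also have "trm_equiv R \<dots> (Plus (lsum ([p] @ ps)) (lsum qs))"
      by (intro ctx_plus1 swap wq)
    also have "trm_equiv R \<dots> (lsum (([p] @ ps) @ qs))"
      by (rule equiv_sym, rule lsum_append) (use qs wf wq trm_equiv_wf[OF swap] in auto)
    finally show ?thesis by simp
  qed
qed

section \<open>Linearity of scaling and of symbols over sums\<close>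

lemma scale_lsum:
  assumes "qs \<noteq> []" "wf_amp R \<alpha>" "wf_trm R (lsum qs)"
  shows "trm_equiv R (Scale \<alpha> (lsum qs)) (lsum (map (\<lambda>(\<beta>, t). (AMul \<alpha> \<beta>, t)) qs))"
  using assms
proof (induction qs rule: lsum.induct)
  case (1 p)
  then show ?case by (auto simp: case_prod_unfold intro: scale_scale)
next
  case (2 p q ps)
  have "trm_equiv R (Scale \<alpha> (lsum (p # q # ps)))
      (Plus (Scale \<alpha> (Scale (fst p) (snd p))) (Scale \<alpha> (lsum (q # ps))))"
    using 2 by (auto intro: scale_plus)
  also have "trm_equiv R \<dots> (Plus (Scale (AMul \<alpha> (fst p)) (snd p))
      (lsum (map (\<lambda>(\<beta>, t). (AMul \<alpha> \<beta>, t)) (q # ps))))"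
    using 2 by (intro equiv_plus scale_scale) auto
  finally show ?case by (simp add: case_prod_unfold)
qed auto

lemma app_lsum:
  assumes "qs \<noteq> []" "wf_trm R (App b (us @ lsum qs # vs))"
  shows "trm_equiv R (App b (us @ lsum qs # vs))
    (lsum (map (\<lambda>(\<beta>, t). (\<beta>, App b (us @ t # vs))) qs))"
  using assms
proof (induction qs rule: lsum.induct)
  case (1 p)
  then show ?case by (auto simp: case_prod_unfold intro: app_scale)
next
  case (2 p q ps)
  have "trm_equiv R (App b (us @ lsum (p # q # ps) # vs))
      (Plus (App b (us @ Scale (fst p) (snd p) # vs)) (App b (us @ lsum (q # ps) # vs)))"
    using 2 by (auto intro: app_plus)
  also have "trm_equiv R \<dots> (Plus (Scale (fst p) (App b (us @ snd p # vs)))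
      (lsum (map (\<lambda>(\<beta>, t). (\<beta>, App b (us @ t # vs))) (q # ps))))"
    using 2 by (intro equiv_plus app_scale) auto
  finally show ?case by (simp add: case_prod_unfold)
qed auto


section \<open>Canonical forms\<close>

text \<open>A precursor of canonical forms: repeated terms and zero coefficients are still allowed,
  while groundness of the amplitudes gives each one a definite value.\<close>

definition good_sum :: "('a, 'c, 'f, 'x, 'b) strs \<Rightarrow>
    (('a, 'x) amp \<times> ('a, 'c, 'f, 'x, 'b) trm) list \<Rightarrow> bool" where
  "good_sum R ps \<longleftrightarrow> ps \<noteq> [] \<and>
     (\<forall>(\<alpha>, t) \<in> set ps. wf_amp R \<alpha> \<and> avars \<alpha> = {} \<and> t \<in> ground_terms R \<and> classical t)"

text \<open>A classical term need not be equivalent to any sum, as there may be no amplitude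
  interpreted as 1.\<close>

definition expands :: "('a, 'c, 'f, 'x, 'b) strs \<Rightarrow> ('a, 'c, 'f, 'x, 'b) trm \<Rightarrow> bool" where
  "expands R t \<longleftrightarrow> (\<exists>c. classical c \<and> c \<in> ground_terms R \<and> trm_equiv R t c) \<or>
     (\<exists>ps. good_sum R ps \<and> trm_equiv R t (lsum ps))"

lemma good_sum_ground: "good_sum R ps \<Longrightarrow> lsum ps \<in> ground_terms R"
  by (auto simp: good_sum_def ground_terms_def wf_lsum tvars_lsum)

lemma expands_equiv: "\<lbrakk>expands R t; trm_equiv R s t\<rbrakk> \<Longrightarrow> expands R s"
  unfolding expands_def using equiv_trans[of R s t] by blast

text \<open>The outer coefficient turns a classical \<open>t\<close> into a one-element sum and is
  multiplied into the coefficients of any other \<open>t\<close>; the resulting sums are then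
  concatenated.\<close>

lemma lsum_expands_good:
  assumes "ps \<noteq> []" "\<forall>(\<alpha>, t) \<in> set ps. wf_amp R \<alpha> \<and> avars \<alpha> = {} \<and> expands R t"
  shows "\<exists>qs. good_sum R qs \<and> trm_equiv R (lsum ps) (lsum qs)"
proof -
  have one: "\<exists>qs. good_sum R qs \<and> trm_equiv R (Scale \<alpha> t) (lsum qs)"
    if \<alpha>: "wf_amp R \<alpha>" "avars \<alpha> = {}" and t: "expands R t" for \<alpha> t
    using t unfolding expands_def
  proof (elim disjE exE conjE)
    fix c assume "classical c" "c \<in> ground_terms R" "trm_equiv R t c"
    with \<alpha> show ?thesis
      by (intro exI[of _ "[(\<alpha>, c)]"]) (auto simp: good_sum_def intro: ctx_scale)
  next
    fix rs assume rs: "good_sum R rs" "trm_equiv R t (lsum rs)"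
    let ?qs = "map (\<lambda>(\<beta>, t). (AMul \<alpha> \<beta>, t)) rs"
    have "trm_equiv R (Scale \<alpha> (lsum rs)) (lsum ?qs)"
      using rs \<alpha> trm_equiv_wf by (intro scale_lsum) (auto simp: good_sum_def)
    then have "trm_equiv R (Scale \<alpha> t) (lsum ?qs)"
      by (rule equiv_trans[OF ctx_scale[OF rs(2) \<alpha>(1)]])
    moreover have "good_sum R ?qs" using rs(1) \<alpha> by (auto simp: good_sum_def)
    ultimately show ?thesis by blast
  qed
  show ?thesis using assms
  proof (induction ps rule: lsum.induct)
    case (1 p)
    then show ?case using one[of "fst p" "snd p"] by (auto simp: case_prod_unfold)
  next
    case (2 p q ps)
    obtain xs where xs: "good_sum R xs" "trm_equiv R (Scale (fst p) (snd p)) (lsum xs)"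
      using 2 one[of "fst p" "snd p"] by (auto simp: case_prod_unfold)
    obtain ys where ys: "good_sum R ys" "trm_equiv R (lsum (q # ps)) (lsum ys)"
      using 2 by auto
    have "trm_equiv R (lsum (p # q # ps)) (Plus (lsum xs) (lsum ys))"
      using equiv_plus[OF xs(2) ys(2)] by simp
    also have "trm_equiv R \<dots> (lsum (xs @ ys))"
      using xs ys trm_equiv_wf
      by (intro equiv_sym[OF lsum_append]) (auto simp: good_sum_def)
    finally have "trm_equiv R (lsum (p # q # ps)) (lsum (xs @ ys))" .
    moreover have "good_sum R (xs @ ys)" using xs ys by (auto simp: good_sum_def)
    ultimately show ?case by blast
  qed auto
qed

text \<open>Arguments are made classical from left to right, \<open>us\<close> being the prefix
  already treated. An argument that is a sum is pulled out of the application by linearity.\<close>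

lemma expands_App:
  assumes "\<forall>t \<in> set ts. expands R t" "\<forall>u \<in> set us. classical u \<and> tvars u = {}"
    "wf_trm R (App b (us @ ts))"
  shows "expands R (App b (us @ ts))"
  using assms
proof (induction ts arbitrary: us)
  case Nil
  then have "classical (App b us)" "App b us \<in> ground_terms R"
    by (auto simp: ground_terms_def)
  moreover have "trm_equiv R (App b us) (App b us)"
    using Nil.prems(3) by (simp add: equiv_refl)
  ultimately show ?case unfolding expands_def append_Nil2 by blast
next
  case (Cons t ts)
  have IH: "expands R (App b (us @ u # ts))" if "classical u" "u \<in> ground_terms R" for u
    using Cons.IH[of "us @ [u]"] Cons.prems that by (auto simp: ground_terms_def)
  have "expands R t" using Cons.prems by simp
  then show ?case unfolding expands_def[of R t]
  proof (elim disjE exE conjE)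
    fix c assume c: "classical c" "c \<in> ground_terms R" "trm_equiv R t c"
    then show ?case using IH[OF c(1,2)] ctx_app[OF c(3) Cons.prems(3)] expands_equiv by blast
  next
    fix ps assume ps: "good_sum R ps" "trm_equiv R t (lsum ps)"
    let ?qs = "map (\<lambda>(\<beta>, t). (\<beta>, App b (us @ t # ts))) ps"
    have e: "trm_equiv R (App b (us @ t # ts)) (App b (us @ lsum ps # ts))"
      by (rule ctx_app[OF ps(2) Cons.prems(3)])
    also have "trm_equiv R \<dots> (lsum ?qs)"
      using ps trm_equiv_wf[OF e] by (intro app_lsum) (auto simp: good_sum_def)
    finally have *: "trm_equiv R (App b (us @ t # ts)) (lsum ?qs)" .
    \<comment> \<open>Each summand is now an application with one more classical argument, hence
      expandable by \<open>IH\<close>; the sum of these expansions is flattened.\<close>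
    have "\<exists>qs. good_sum R qs \<and> trm_equiv R (lsum ?qs) (lsum qs)"
      using ps IH by (intro lsum_expands_good) (auto simp: good_sum_def)
    then show ?case unfolding expands_def using equiv_trans[OF *] by blast
  qed
qed

section \<open>Ground amplitudes and the shortening of sums\<close>

lemma aeval_ground: "avars \<alpha> = {} \<Longrightarrow> aeval R \<rho> \<alpha> = aval R \<alpha>"
proof -
  have n: "nvars n = {} \<Longrightarrow> neval \<rho> n = neval \<rho>' n" for n and \<rho> \<rho>' :: "_ \<Rightarrow> nat"
    by (induction n) auto
  show "avars \<alpha> = {} \<Longrightarrow> aeval R \<rho> \<alpha> = aval R \<alpha>"
    unfolding aval_def
  proof (induction \<alpha>)
    case (Amp a ns)
    then have "map (neval \<rho>) ns = map (neval (\<lambda>_. 0)) ns" by (auto intro: n)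
    then show ?case by (simp only: aeval.simps)
  qed auto
qed

lemma amp_is_aval: "avars \<alpha> = {} \<Longrightarrow> amp_is R \<alpha> (aval R \<alpha>)"
  by (simp add: amp_is_def aeval_ground)

text \<open>Two occurrences of a term merge by adding their coefficients, and a zero summand is
  absorbed by the others. Absorption needs another summand, hence the bound on the length.\<close>

lemma good_sum_shorten:
  assumes good: "good_sum R ps" and "\<not> (distinct (map snd ps) \<and> (\<forall>(\<alpha>, t) \<in> set ps. aval R \<alpha> \<noteq> 0))"
    and two: "length ps \<ge> 2"
  shows "\<exists>qs. good_sum R qs \<and> length qs < length ps \<and> trm_equiv R (lsum ps) (lsum qs)"
proof -
  have wf: "wf_trm R (lsum ps)" using good_sum_ground[OF good] by (simp add: ground_terms_def)
  consider (dup) "\<not> distinct (map snd ps)" | (zero) \<alpha> t where "(\<alpha>, t) \<in> set ps" "aval R \<alpha> = 0"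
    using assms(2) by blast
  then show ?thesis
  proof cases
    case dup
    then obtain as bs cs t where "map snd ps = as @ [t] @ bs @ [t] @ cs"
      using not_distinct_decomp by blast
    then obtain xs ys zs \<alpha> \<beta> where ps: "ps = xs @ (\<alpha>, t) # ys @ (\<beta>, t) # zs"
      by (auto simp: map_eq_append_conv append_eq_map_conv Cons_eq_map_conv)
    let ?r = "xs @ ys @ zs"
    have g: "good_sum R ((AAdd \<alpha> \<beta>, t) # ?r)" using good ps by (auto simp: good_sum_def)
    have wr: "wf_trm R (lsum ?r)" if "?r \<noteq> []"
      using g that by (subst wf_lsum) (auto simp: good_sum_def ground_terms_def)
    have t: "wf_trm R t" "wf_amp R \<alpha>" "wf_amp R \<beta>"
      using good ps by (auto simp: good_sum_def ground_terms_def)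
    \<comment> \<open>The later occurrence of \<open>t\<close> goes to the front first and the
      earlier one after it, so that the two end up adjacent in their original order.\<close>
    have e1: "trm_equiv R (lsum ps) (lsum ((\<beta>, t) # (xs @ (\<alpha>, t) # ys) @ zs))"
      using lsum_to_front[of R "xs @ (\<alpha>, t) # ys" "(\<beta>, t)" zs] wf ps by simp
    have "trm_equiv R (lsum (((\<beta>, t) # xs) @ (\<alpha>, t) # ys @ zs))
        (lsum ((\<alpha>, t) # ((\<beta>, t) # xs) @ ys @ zs))"
      using trm_equiv_wf[OF e1] by (intro lsum_to_front) auto
    with e1 have e2: "trm_equiv R (lsum ps) (lsum ((\<alpha>, t) # (\<beta>, t) # ?r))"
      by (intro equiv_trans[OF e1]) simp
    have e3: "trm_equiv R (lsum ((\<alpha>, t) # (\<beta>, t) # ?r)) (lsum ((AAdd \<alpha> \<beta>, t) # ?r))"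
    proof (cases ?r)
      case Nil
      then show ?thesis using t by (auto intro: plus_scale)
    next
      case (Cons q qs)
      have "trm_equiv R (Plus (Scale \<alpha> t) (Plus (Scale \<beta> t) (lsum ?r)))
          (Plus (Plus (Scale \<alpha> t) (Scale \<beta> t)) (lsum ?r))"
        using t wr Cons by (intro plus_assoc) auto
      also have "trm_equiv R \<dots> (Plus (Scale (AAdd \<alpha> \<beta>) t) (lsum ?r))"
        using t wr Cons by (intro ctx_plus1 plus_scale) auto
      finally show ?thesis unfolding Cons by simp
    qed
    show ?thesis
      using g equiv_trans[OF e2 e3] ps by (intro exI[of _ "(AAdd \<alpha> \<beta>, t) # ?r"]) auto
  next
    case zero
    then obtain xs ys where ps: "ps = xs @ (\<alpha>, t) # ys" using split_list by fastforce
    let ?r = "xs @ ys"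
    have ne: "?r \<noteq> []" using two ps by auto
    then have g: "good_sum R ?r" using good ps by (auto simp: good_sum_def)
    have wr: "wf_trm R (lsum ?r)" using good_sum_ground[OF g] by (simp add: ground_terms_def)
    have t: "wf_trm R t" "wf_amp R \<alpha>" "avars \<alpha> = {}"
      using good ps by (auto simp: good_sum_def ground_terms_def)
    have "trm_equiv R (lsum ps) (lsum ((\<alpha>, t) # ?r))"
      using wf unfolding ps by (rule lsum_to_front)
    also have "lsum ((\<alpha>, t) # ?r) = Plus (Scale \<alpha> t) (lsum ?r)"
      using ne by (cases ?r) auto
    \<comment> \<open>\<open>plus_zero\<close> erases a right summand only.\<close>
    also have "trm_equiv R \<dots> (Plus (lsum ?r) (Scale \<alpha> t))"
      using t wr by (intro plus_comm) auto
    also have "trm_equiv R \<dots> (lsum ?r)"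
      using t wr zero(2) amp_is_aval[of \<alpha> R] by (intro plus_zero) auto
    finally have "trm_equiv R (lsum ps) (lsum ?r)" .
    with g ps show ?thesis by (intro exI[of _ ?r]) auto
  qed
qed

text \<open>Shortening terminates because the length drops. It can get stuck short of a canonical
  form only at a single summand with coefficient 0.\<close>

lemma good_sum_canonical:
  assumes "good_sum R ps"
  shows "\<exists>qs. good_sum R qs \<and> trm_equiv R (lsum ps) (lsum qs) \<and>
    (lsum qs \<in> CAN R \<or> (\<exists>\<alpha> t. qs = [(\<alpha>, t)] \<and> aval R \<alpha> = 0))"
  using assms
proof (induction "length ps" arbitrary: ps rule: less_induct)
  case less
  have refl: "trm_equiv R (lsum ps) (lsum ps)"
    using good_sum_ground[OF less.prems] by (auto simp: ground_terms_def intro: equiv_refl)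
  show ?case
  proof (cases "distinct (map snd ps) \<and> (\<forall>(\<alpha>, t) \<in> set ps. aval R \<alpha> \<noteq> 0)")
    case True
    have "\<forall>(\<alpha>, t) \<in> set ps. wf_amp R \<alpha> \<and> wf_trm R t \<and> classical t \<and> (\<exists>z. z \<noteq> 0 \<and> amp_is R \<alpha> z)"
    proof (intro ballI, clarify)
      fix \<alpha> t assume "(\<alpha>, t) \<in> set ps"
      then have "wf_amp R \<alpha> \<and> avars \<alpha> = {} \<and> t \<in> ground_terms R \<and> classical t" "aval R \<alpha> \<noteq> 0"
        using less.prems True by (auto simp: good_sum_def)
      then show "wf_amp R \<alpha> \<and> wf_trm R t \<and> classical t \<and> (\<exists>z. z \<noteq> 0 \<and> amp_is R \<alpha> z)"
        using amp_is_aval[of \<alpha> R] by (auto simp: ground_terms_def)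
    qed
    then have "lsum ps \<in> CAN R"
      using less.prems True unfolding CAN_def good_sum_def by blast
    with refl less.prems show ?thesis by blast
  next
    case bad: False
    show ?thesis
    proof (cases "length ps \<ge> 2")
      case True
      then obtain qs where qs: "good_sum R qs" "length qs < length ps"
        "trm_equiv R (lsum ps) (lsum qs)"
        using good_sum_shorten[OF less.prems bad] by blast
      show ?thesis using less.hyps[OF qs(2,1)] equiv_trans[OF qs(3)] by blast
    next
      case False
      then obtain \<alpha> t where "ps = [(\<alpha>, t)]"
        using less.prems by (cases ps rule: lsum.cases) (auto simp: good_sum_def)
      \<comment> \<open>A one-element list is distinct, so \<open>bad\<close> forces its coefficient
        to be 0.\<close>
      with bad refl less.prems show ?thesis by auto
    qed
  qed
qed

text \<open>Both terms are equivalent to their sum, from which either summand can be erased. This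
  exchanges the term under a lone zero coefficient.\<close>

lemma zero_scale_equiv:
  assumes "wf_trm R s" "wf_trm R t" "wf_amp R \<alpha>" "amp_is R \<alpha> 0"
  shows "trm_equiv R (Scale \<alpha> s) (Scale \<alpha> t)"
proof -
  have "trm_equiv R (Scale \<alpha> s) (Plus (Scale \<alpha> s) (Scale \<alpha> t))"
    using assms by (intro equiv_sym[OF plus_zero]) auto
  also have "trm_equiv R \<dots> (Plus (Scale \<alpha> t) (Scale \<alpha> s))"
    using assms by (intro plus_comm) auto
  also have "trm_equiv R \<dots> (Scale \<alpha> t)"
    using assms by (intro plus_zero) auto
  finally show ?thesis .
qed


section \<open>Typing of the classical components\<close>

lemma tvars_nexp_trm: "tvars (nexp_trm n) = nvars n"
  by (induction n) auto

text \<open>The bound on the variables survives \<open>conv\<close> only through its side condition,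
  since \<open>plus_zero\<close> read backwards introduces arbitrary variables.\<close>

lemma typ_with_wf:
  "typ_with R V \<Gamma> \<Delta> t T \<Longrightarrow> wf_trm R t \<and> tvars t \<subseteq> dom \<Gamma> \<union> dom \<Delta>"
  "amp_with R V \<Gamma> \<alpha> \<Longrightarrow> wf_amp R \<alpha> \<and> avars \<alpha> \<subseteq> dom \<Gamma>"
proof (induction rule: typ_with_amp_with.inducts)
  case (conv \<Gamma> \<Delta> s T t)
  then show ?case using trm_equiv_wf by blast
next
  case (symb b Ts T ts \<Delta>s \<Gamma>)
  have dom: "dom \<Delta> \<subseteq> dom (foldr (++) \<Delta>s Map.empty)" if "\<Delta> \<in> set \<Delta>s" for \<Delta>
    using that by (induction \<Delta>s) auto
  have "wf_trm R t \<and> tvars t \<subseteq> dom \<Gamma> \<union> dom (foldr (++) \<Delta>s Map.empty)" if "t \<in> set ts" for t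
  proof -
    obtain i where i: "i < length Ts" "t = ts ! i"
      using \<open>t \<in> set ts\<close> symb.hyps by (metis in_set_conv_nth)
    then have "wf_trm R t \<and> tvars t \<subseteq> dom \<Gamma> \<union> dom (\<Delta>s ! i)" using symb.IH by simp
    moreover have "\<Delta>s ! i \<in> set \<Delta>s" using i symb.hyps by simp
    ultimately show ?thesis using dom by blast
  qed
  then show ?case using symb.IH(1,2) symb.hyps by (auto simp: sym_ar_def)
next
  case (sup T ts \<alpha>s \<Gamma> \<Delta>)
  then have "zip \<alpha>s ts \<noteq> []" by (cases ts; cases \<alpha>s) auto
  moreover have "wf_amp R \<alpha> \<and> wf_trm R t \<and> avars \<alpha> \<union> tvars t \<subseteq> dom \<Gamma> \<union> dom \<Delta>"
    if "(\<alpha>, t) \<in> set (zip \<alpha>s ts)" for \<alpha> t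
    using that sup by (fastforce simp: set_zip)
  ultimately show ?case by (fastforce simp: wf_lsum tvars_lsum)
next
  case (amp a ns \<Gamma>)
  then have "nvars n \<subseteq> dom \<Gamma>" if "n \<in> set ns" for n
    using that by (auto simp: in_set_conv_nth tvars_nexp_trm)
  with amp show ?case by (simp add: UN_subset_iff)
qed auto

text \<open>Typing an application splits the linear context among the arguments; under an empty
  context every argument is therefore closed again.\<close>

lemma foldr_map_add_empty:
  assumes "foldr (++) \<Delta>s Map.empty = Map.empty" "\<Delta> \<in> set \<Delta>s"
  shows "\<Delta> = Map.empty"
proof -
  have "dom \<Delta> \<subseteq> dom (foldr (++) \<Delta>s Map.empty)" using assms(2) by (induction \<Delta>s) auto
  with assms(1) show ?thesis by simp
qed

text \<open>\<open>expands\<close> is invariant under equivalence, which settles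
  \<open>conv\<close>; \<open>symb\<close> and \<open>sup\<close> are the closure properties shown
  above. The trivial second claim completes the mutual induction.\<close>

lemma typ_with_expands:
  "typ_with R V \<Gamma> \<Delta> t T \<Longrightarrow> \<Gamma> = Map.empty \<Longrightarrow> \<Delta> = Map.empty \<Longrightarrow> expands R t"
  "amp_with R V \<Gamma> \<alpha> \<Longrightarrow> True"
proof (induction rule: typ_with_amp_with.inducts)
  case (conv \<Gamma> \<Delta> s T t)
  then show ?case using expands_equiv equiv_sym by blast
next
  case (symb b Ts T ts \<Delta>s \<Gamma>)
  have \<Delta>: "\<Delta>s ! i = Map.empty" if "i < length Ts" for i
    using that symb foldr_map_add_empty by (metis nth_mem)
  have "typ_with R V \<Gamma> (foldr (++) \<Delta>s Map.empty) (App b ts) T"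
    using symb by (intro typ_with_amp_with.symb) auto
  then have "wf_trm R (App b ([] @ ts))" using typ_with_wf(1) by fastforce
  moreover have "\<forall>t \<in> set ts. expands R t"
    using symb \<Delta> by (auto simp: in_set_conv_nth)
  ultimately have "expands R (App b ([] @ ts))" by (intro expands_App) auto
  then show ?case by simp
next
  case (sup T ts \<alpha>s \<Gamma> \<Delta>)
  then have "zip \<alpha>s ts \<noteq> []" by (cases ts; cases \<alpha>s) auto
  moreover have "wf_amp R \<alpha> \<and> avars \<alpha> = {} \<and> expands R t"
    if "(\<alpha>, t) \<in> set (zip \<alpha>s ts)" for \<alpha> t
    using that sup typ_with_wf(2) by (fastforce simp: set_zip)
  ultimately have "\<exists>qs. good_sum R qs \<and> trm_equiv R (lsum (zip \<alpha>s ts)) (lsum qs)"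
    by (intro lsum_expands_good) auto
  then show ?case unfolding expands_def by blast
qed auto

text \<open>Typing read off the signatures alone, without variables, conversion or superposition.
  Unlike \<open>typ_with\<close>, it can be inverted along the structure of the term.\<close>

inductive styp :: "('a, 'c, 'f, 'x, 'b) strs \<Rightarrow> ('a, 'c, 'f, 'x, 'b) trm \<Rightarrow> 'b ty \<Rightarrow> bool"
  for R where
  styp_App: "\<lbrakk>sym_in R b; sym_sig R b = (Ts, T); list_all2 (styp R) ts Ts\<rbrakk> \<Longrightarrow> styp R (App b ts) T"

lemma foldr_map_add_replicate_empty:
  "foldr (++) (replicate n Map.empty) Map.empty = Map.empty"
  by (induction n) auto

lemma styp_typ_with: "styp R t T \<Longrightarrow> typ_with R V Map.empty Map.empty t T"
proof (induction rule: styp.induct)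
  case (styp_App b Ts T ts)
  let ?\<Delta>s = "replicate (length Ts) Map.empty"
  have "typ_with R V Map.empty (foldr (++) ?\<Delta>s Map.empty) (App b ts) T"
    using styp_App
    by (intro typ_with_amp_with.symb) (auto simp: list_all2_conv_all_nth sorted_wrt_iff_nth_less)
  then show ?case unfolding foldr_map_add_replicate_empty .
qed

lemma closed_typing_unfold:
  "closed_typing R = typ_with R (closed_typing R) Map.empty Map.empty"
  unfolding closed_typing_def by (subst typing_unfold) (simp add: closed_typing_def)

lemma styp_closed_typing: "styp R t T \<Longrightarrow> closed_typing R t T"
  by (subst closed_typing_unfold) (rule styp_typ_with)

section \<open>Supports of closed typed terms\<close>

lemma prod_list_map2_nonzero:
  fixes f :: "'p \<Rightarrow> 'q \<Rightarrow> complex"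
  assumes "prod_list (map2 f xs ys) \<noteq> 0" "length xs = length ys"
  shows "list_all2 (\<lambda>x y. f x y \<noteq> 0) xs ys"
  using assms(2,1) by (induction xs ys rule: list_induct2) auto

lemma vec_App_nonzeroE:
  assumes "vec R (App b ts) c \<noteq> 0"
  obtains us where "c = App b us" "list_all2 (\<lambda>t u. vec R t u \<noteq> 0) ts us"
proof -
  from assms obtain us where "c = App b us" "length us = length ts"
    "prod_list (map2 (vec R) ts us) \<noteq> 0"
    by (auto simp: vec_App split: trm.splits if_splits)
  then show thesis using that[of us] prod_list_map2_nonzero[of "vec R" ts us] by simp
qed

text \<open>Conversion may change the shape of a typed term but not its vector, by
  \<open>trm_equiv_vec\<close>, so types are tracked on the support. A term in the support of a
  superposition lies in the support of one of the superposed terms, and the support of an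
  application consists of applications of the same symbol.\<close>

lemma typ_with_support:
  "typ_with R V \<Gamma> \<Delta> t T \<Longrightarrow> \<Gamma> = Map.empty \<Longrightarrow> \<Delta> = Map.empty \<Longrightarrow> vec R t c \<noteq> 0 \<Longrightarrow> styp R c T"
  "amp_with R V \<Gamma> \<alpha> \<Longrightarrow> True"
proof (induction arbitrary: c rule: typ_with_amp_with.inducts)
  case (conv \<Gamma> \<Delta> s T t)
  then show ?case using trm_equiv_vec by metis
next
  case (symb b Ts T ts \<Delta>s \<Gamma>)
  have \<Delta>: "\<Delta>s ! i = Map.empty" if "i < length Ts" for i
    using that symb foldr_map_add_empty by (metis nth_mem)
  obtain us where "c = App b us" "list_all2 (\<lambda>t u. vec R t u \<noteq> 0) ts us"
    using symb.prems vec_App_nonzeroE by blast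
  then show ?case
    using symb \<Delta> by (auto simp: list_all2_conv_all_nth intro!: styp_App)
next
  case (sup T ts \<alpha>s \<Gamma> \<Delta>)
  then have "zip \<alpha>s ts \<noteq> []" by (cases ts; cases \<alpha>s) auto
  with sup.prems have "sum_list (map (\<lambda>(\<alpha>, t). aval R \<alpha> * vec R t c) (zip \<alpha>s ts)) \<noteq> 0"
    by (simp add: vec_lsum)
  then obtain p where "p \<in> set (zip \<alpha>s ts)" "(case p of (\<alpha>, t) \<Rightarrow> aval R \<alpha> * vec R t c) \<noteq> 0"
    by (metis (no_types, lifting) sum_list_0 map_cong)
  then obtain i where "i < length ts" "vec R (ts ! i) c \<noteq> 0"
    by (auto simp: set_zip)
  with sup show ?case by blast
qed auto


section \<open>Progress\<close>

lemma is_value_ground: "is_value R v \<Longrightarrow> v \<in> ground_terms R"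
  by (induction rule: is_value.induct) (auto simp: ground_terms_def)

lemma nvars_numeral_nexp: "nvars (numeral_nexp k) = {}"
  by (induction k) auto

lemma nvars_nsubst: "nvars (nsubst R \<sigma> n) = {}"
  by (induction n) (auto simp: nvars_numeral_nexp)

text \<open>Every variable of an amplitude is replaced by some numeral, whatever
  \<open>\<sigma>\<close> assigns to it.\<close>

lemma asubst_ground: "wf_amp R \<alpha> \<Longrightarrow> wf_amp R (asubst R \<sigma> \<alpha>) \<and> avars (asubst R \<sigma> \<alpha>) = {}"
  by (induction \<alpha>) (auto simp: nvars_nsubst)

lemma tsubst_ground:
  "\<lbrakk>is_subst R \<sigma>; wf_trm R t\<rbrakk> \<Longrightarrow> tsubst R \<sigma> t \<in> ground_terms R"
proof (induction t)
  case (Var x)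
  then show ?case by (simp add: is_subst_def is_value_ground)
qed (auto simp: ground_terms_def asubst_ground)

lemma fill_ground:
  "\<lbrakk>fill E s \<in> ground_terms R; t \<in> ground_terms R\<rbrakk> \<Longrightarrow> fill E t \<in> ground_terms R"
  by (induction E) (auto simp: ground_terms_def sym_ar_def)

lemma styp_ground: "styp R t T \<Longrightarrow> t \<in> ground_terms R"
  using typ_with_wf(1)[OF styp_typ_with] by (fastforce simp: ground_terms_def)

lemma styp_classical: "styp R t T \<Longrightarrow> classical t"
  by (induction rule: styp.induct) (auto simp: list_all2_conv_all_nth in_set_conv_nth)

text \<open>If all arguments are values, a constructor yields a value and a function symbol a redex
  candidate at the root. Otherwise the leftmost argument that is not a value contains one, and the
  values to its left make the surrounding context an evaluation context.\<close>

lemma styp_progress: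
  assumes "styp R t T"
  shows "is_value R t \<or> (\<exists>E f vs. is_ectx R E \<and> f \<in> fun_syms R \<and> vs \<in> inputs R (Fun f) \<and>
    t = fill E (App (Fun f) vs))"
  using assms
proof (induction rule: styp.induct)
  case (styp_App b Ts T ts)
  have len: "length ts = sym_ar R b"
    using styp_App by (auto simp: sym_ar_def dest: list_all2_lengthD)
  show ?case
  proof (cases "\<forall>t \<in> set ts. is_value R t")
    case True
    show ?thesis
    proof (cases b)
      case (Con c)
      with True len styp_App show ?thesis by (auto intro: value_con)
    next
      case (Fun f)
      have "closed_typing R (ts ! i) (Ts ! i)" if "i < length ts" for i
        by (rule styp_closed_typing) (use that styp_App.IH in \<open>auto simp: list_all2_conv_all_nth\<close>)
      then have "ts \<in> inputs R (Fun f)"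
        using Fun styp_App True by (auto simp: inputs_def list_all2_conv_all_nth)
      moreover have "f \<in> fun_syms R" using Fun styp_App by (simp add: sym_in_def)
      ultimately show ?thesis
        using Fun by (intro disjI2 exI[of _ EHole]) auto
    qed
  next
    case False
    then have "\<exists>t \<in> set ts. \<not> is_value R t" by blast
    then obtain us s ws where ts: "ts = us @ s # ws" "\<not> is_value R s" "\<forall>u \<in> set us. is_value R u"
      using split_list_first_prop[of ts "\<lambda>t. \<not> is_value R t"] by auto
    have "ts ! i \<in> ground_terms R" if "i < length ts" for i
      by (rule styp_ground) (use that styp_App.IH in \<open>auto simp: list_all2_conv_all_nth\<close>)
    then have wf: "\<forall>t \<in> set ts. wf_trm R t" by (auto simp: in_set_conv_nth ground_terms_def)
    obtain E f vs where E: "is_ectx R E" "f \<in> fun_syms R" "vs \<in> inputs R (Fun f)"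
      "s = fill E (App (Fun f) vs)"
      using styp_App.IH ts(1,2) by (auto simp: list_all2_append1 list_all2_Cons1)
    have "is_ectx R (EApp b us E ws)" "App b ts = fill (EApp b us E ws) (App (Fun f) vs)"
      using ts wf len E styp_App(1) by auto
    with E(2,3) show ?thesis by blast
  qed
qed

section \<open>Reducibility of classical terms and of sums\<close>

lemma red_with_ground: "red_with R N s t \<Longrightarrow> t \<in> ground_terms R"
  by (induction rule: red_with.induct) auto

text \<open>Totality matches the application found by \<open>styp_progress\<close> with a left-hand
  side; \<open>red_C\<close> then applies because the whole term is classical.\<close>

lemma styp_value_or_red:
  assumes "is_strs R" "total_qtrs R" "styp R t T"
  shows "is_value R t \<or> (\<exists>u. red R t u)"
  using styp_progress[OF assms(3)]
proof (elim disjE exE conjE)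
  fix E f vs
  assume E: "is_ectx R E" "f \<in> fun_syms R" "vs \<in> inputs R (Fun f)" "t = fill E (App (Fun f) vs)"
  then obtain \<sigma> l r where \<sigma>: "is_subst R \<sigma>" "(l, r) \<in> rules R" "tsubst R \<sigma> l = App (Fun f) vs"
    using assms(2) unfolding total_qtrs_def by blast
  have "wf_trm R r" using assms(1) \<sigma>(2) by (auto simp: is_strs_def is_rule_def)
  then have "fill E (tsubst R \<sigma> r) \<in> ground_terms R"
    using fill_ground tsubst_ground[OF \<sigma>(1)] styp_ground[OF assms(3)] E(4) by metis
  then have "red_with R (NF R) (fill E (tsubst R \<sigma> l)) (fill E (tsubst R \<sigma> r))"
    using \<sigma> E styp_ground[OF assms(3)] styp_classical[OF assms(3)] by (intro red_C) auto
  then show ?thesis using \<sigma>(3) E(4) red_unfold by metis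
qed auto

lemma is_value_lsum:
  "\<lbrakk>good_sum R ps; \<forall>(\<alpha>, t) \<in> set ps. is_value R t\<rbrakk> \<Longrightarrow> is_value R (lsum ps)"
  by (induction ps rule: lsum.induct) (auto simp: good_sum_def intro!: value_scale value_plus)

text \<open>By \<open>red_E\<close>, any step from \<open>t\<close> is also a step from
  \<open>s\<close>.\<close>

lemma NF_equiv:
  assumes "s \<in> NF R" "trm_equiv R s t" "t \<in> ground_terms R"
  shows "\<not> red R t u"
proof
  assume "red R t u"
  then have u: "red_with R (NF R) t u" by (simp add: red_unfold)
  then have g: "u \<in> ground_terms R" by (rule red_with_ground)
  have "red_with R (NF R) s u"
    using assms u g by (intro red_E[OF assms(2) u])
      (auto simp: ground_terms_def NF_def NF_of_def intro: equiv_refl)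
  then have "red R s u" by (simp add: red_unfold)
  with assms(1) show False by (simp add: NF_def NF_of_def)
qed

text \<open>\<open>red_Q\<close> moves all components at once, so one reducible component suffices
  as long as the normal ones are allowed to stay.\<close>

lemma CAN_red:
  assumes "lsum ps \<in> CAN R" "good_sum R ps" "(\<alpha>, t) \<in> set ps" "red R t u"
  shows "\<exists>w. red R (lsum ps) w"
proof -
  \<comment> \<open>The simultaneous step: normal forms are kept, every other component moves to
    some chosen reduct.\<close>
  define nxt where "nxt s = (if s \<in> NF R then s else SOME w. red R s w)" for s
  let ?ss = "map snd ps" and ?ts = "map (nxt \<circ> snd) ps"
  have step: "s \<in> NF R \<and> nxt s = s \<or> red R s (nxt s)" if "s \<in> ground_terms R" for s
    using that someI_ex[of "red R s"] by (auto simp: nxt_def NF_def NF_of_def)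
  have gr: "snd p \<in> ground_terms R" if "p \<in> set ps" for p
    using that assms(2) by (auto simp: good_sum_def)
  have nxt_gr: "nxt s \<in> ground_terms R" if "s \<in> ground_terms R" for s
    using step[OF that] that red_with_ground by (metis red_unfold)
  have zips: "zip (map fst ps) ?ss = ps" "zip (map fst ps) ?ts = map (\<lambda>p. (fst p, nxt (snd p))) ps"
    by (induction ps) auto
  obtain i where i: "i < length ps" "ps ! i = (\<alpha>, t)" using assms(3) by (auto simp: in_set_conv_nth)
  have "t \<notin> NF R" using assms(4) by (auto simp: NF_def NF_of_def)
  then have "red R t (nxt t)" using step gr[OF assms(3)] by auto
  then have ex: "\<exists>i < length ?ss. red_with R (NF R) (?ss ! i) (?ts ! i)"
    using i by (intro exI[of _ i]) (auto simp: red_unfold[symmetric])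
  have "red_with R (NF R) (lsum (zip (map fst ps) ?ss)) (lsum (zip (map fst ps) ?ts))"
  proof (rule red_Q[OF _ _ _ _ _ ex])
    show "?ss \<noteq> []" using assms(2) by (simp add: good_sum_def)
    show "lsum (zip (map fst ps) ?ss) \<in> CAN R" "lsum (zip (map fst ps) ?ss) \<in> ground_terms R"
      using assms(1) good_sum_ground[OF assms(2)] by (simp_all only: zips)
    show "\<forall>i < length ?ss. ?ss ! i \<in> NF R \<and> ?ts ! i = ?ss ! i \<or>
        red_with R (NF R) (?ss ! i) (?ts ! i)"
      using step gr by (auto simp: red_unfold[symmetric])
    show "lsum (zip (map fst ps) ?ts) \<in> ground_terms R"
      using assms(2) nxt_gr[OF gr] unfolding zips
      by (auto simp: ground_terms_def good_sum_def wf_lsum tvars_lsum)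
  qed auto
  then show ?thesis by (metis zips(1) red_unfold)
qed

text \<open>Each term of the support is a value or reducible. Reducibility would pass to the
  classical or canonical form of \<open>t\<close>, and from there to \<open>t\<close>
  itself.\<close>

lemma typed_NF_value:
  assumes R: "is_strs R" "total_qtrs R" and t: "t \<in> NF R" "closed_typing R t T"
  shows "\<exists>v. is_value R v \<and> trm_equiv R t v"
proof -
  have ty: "typ_with R (closed_typing R) Map.empty Map.empty t T"
    using t(2) closed_typing_unfold by metis
  have supp: "is_value R c \<or> (\<exists>u. red R c u)" if "vec R t c \<noteq> 0" for c
    using styp_value_or_red[OF R typ_with_support(1)[OF ty]] that by blast
  have "expands R t" using typ_with_expands(1)[OF ty] by simp
  then show ?thesis unfolding expands_def
  proof (elim disjE exE conjE)
    fix c assume c: "classical c" "c \<in> ground_terms R" "trm_equiv R t c"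
    then have "vec R t c \<noteq> 0" by (simp add: trm_equiv_vec[OF c(3)] vec_classical)
    then show ?thesis using supp NF_equiv[OF t(1) c(3,2)] c(3) by blast
  next
    fix ps assume "good_sum R ps" "trm_equiv R t (lsum ps)"
    then obtain qs where qs: "good_sum R qs" "trm_equiv R t (lsum qs)"
      "lsum qs \<in> CAN R \<or> (\<exists>\<alpha> t. qs = [(\<alpha>, t)] \<and> aval R \<alpha> = 0)"
      using good_sum_canonical[of R ps] equiv_trans[of R t "lsum ps"] by blast
    from qs(3) show ?thesis
    proof (elim disjE exE conjE)
      assume can: "lsum qs \<in> CAN R"
      have "is_value R c" if c: "(\<alpha>, c) \<in> set qs" for \<alpha> c
      proof -
        have "qs \<noteq> []" using c by auto
        then have "vec R t c \<noteq> 0"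
          using trm_equiv_vec[OF qs(2)] vec_CAN[OF can c] CAN_lsumD(2)[OF can _ c] by simp
        moreover have "\<not> red R c u" for u
          using CAN_red[OF can qs(1) c] NF_equiv[OF t(1) qs(2) good_sum_ground[OF qs(1)]] by blast
        ultimately show ?thesis using supp by blast
      qed
      then have "is_value R (lsum qs)" using qs(1) by (intro is_value_lsum) auto
      with qs(2) show ?thesis by blast
    next
      fix \<alpha> s assume z: "qs = [(\<alpha>, s)]" "aval R \<alpha> = 0"
      \<comment> \<open>The term \<open>s\<close> under the zero coefficient may be no value, so the
        unit value takes its place.\<close>
      let ?u = "App (Con Unit) []"
      have u: "is_value R ?u" by (rule value_con) (auto simp: sym_in_def sym_ar_def)
      have \<alpha>: "wf_amp R \<alpha>" "avars \<alpha> = {}" "wf_trm R s"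
        using z qs(1) by (auto simp: good_sum_def ground_terms_def)
      have "trm_equiv R (Scale \<alpha> s) (Scale \<alpha> ?u)"
        using \<alpha> z(2) amp_is_aval[OF \<alpha>(2), of R] is_value_ground[OF u]
        by (intro zero_scale_equiv) (auto simp: ground_terms_def)
      then have "trm_equiv R t (Scale \<alpha> ?u)" using equiv_trans qs(2) z(1) by fastforce
      then show ?thesis using value_scale[OF \<alpha>(1,2) u] by blast
    qed
  qed
qed


section \<open>Values are irreducible\<close>

lemma is_value_support: "\<lbrakk>is_value R v; vec R v c \<noteq> 0\<rbrakk> \<Longrightarrow> no_funs c"
proof (induction arbitrary: c rule: is_value.induct)
  case (value_con k vs)
  from value_con.prems obtain us where us: "c = App (Con k) us"
    "list_all2 (\<lambda>t u. vec R t u \<noteq> 0) vs us" by (rule vec_App_nonzeroE)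
  then have "\<forall>u \<in> set us. no_funs u"
    using value_con.IH by (fastforce simp: list_all2_conv_all_nth in_set_conv_nth)
  with us(1) show ?case by simp
next
  case (value_plus v w)
  then show ?case by (metis vec.simps(4) add_0)
qed auto

lemma no_funs_fill: "no_funs (fill E t) \<Longrightarrow> no_funs t"
  by (induction E) auto

text \<open>A classical redex term has coefficient 1 at itself. In a canonical sum nothing cancels,
  so a reducible component keeps its nonzero coefficient; equivalence preserves the vector.\<close>

lemma red_with_support:
  assumes "is_strs R" "red_with R N s t"
  shows "\<exists>c. vec R s c \<noteq> 0 \<and> \<not> no_funs c"
  using assms(2)
proof (induction rule: red_with.induct)
  case (red_C l r \<sigma> E)
  obtain f ps where "l = App (Fun f) ps"
    using assms(1) red_C(1) by (auto simp: is_strs_def is_rule_def)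
  then have "\<not> no_funs (tsubst R \<sigma> l)" by simp
  then have "\<not> no_funs (fill E (tsubst R \<sigma> l))" using no_funs_fill by blast
  with red_C show ?case by (intro exI[of _ "fill E (tsubst R \<sigma> l)"]) (simp add: vec_classical)
next
  case (red_E s s' t' t)
  then show ?case by (simp add: trm_equiv_vec)
next
  case (red_Q ss \<alpha>s ts)
  then obtain i where i: "i < length ss" and "\<exists>c. vec R (ss ! i) c \<noteq> 0 \<and> \<not> no_funs c" by blast
  then obtain c where c: "vec R (ss ! i) c \<noteq> 0" "\<not> no_funs c" by blast
  have mem: "(\<alpha>s ! i, ss ! i) \<in> set (zip \<alpha>s ss)" using i red_Q.hyps(2) by (auto simp: set_zip)
  then have d: "classical (ss ! i) \<and> aval R (\<alpha>s ! i) \<noteq> 0"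
    using CAN_lsumD(2)[OF red_Q.hyps(4) _ mem] by fastforce
  \<comment> \<open>The support of a classical term is that term alone.\<close>
  with c have "c = ss ! i" by (simp add: vec_classical split: if_splits)
  with c d show ?case using vec_CAN[OF red_Q.hyps(4) mem] by (intro exI[of _ c]) simp
qed

text \<open>A step from \<open>t\<close> would put a term with a function symbol into its support,
  which is also the support of the value \<open>v\<close>.\<close>

lemma equiv_value_NF:
  assumes "is_strs R" "t \<in> ground_terms R" "is_value R v" "trm_equiv R t v"
  shows "t \<in> NF R"
proof -
  have "\<not> red R t u" for u
    using red_with_support[OF assms(1)] is_value_support[OF assms(3)] trm_equiv_vec[OF assms(4)]
    by (metis red_unfold)
  with assms(2) show ?thesis by (simp add: NF_def NF_of_def)
qed

text \<open>The equality is read among closed well-typed terms, hence the typing condition on both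
  sides; \<open>typed_NF_value\<close> and \<open>equiv_value_NF\<close> give the two
  inclusions.\<close>

theorem lemma14:
  fixes R :: "('a, 'c, 'f, 'x :: countable, 'b :: countable) strs"
  assumes "qtrs R" and "total_qtrs R"
  shows "{t \<in> NF R. \<exists>T. closed_typing R t T} =
         {t \<in> ground_terms R. (\<exists>T. closed_typing R t T) \<and> (\<exists>v. is_value R v \<and> trm_equiv R t v)}"
proof -
  have R: "is_strs R" using assms(1) by (simp add: qtrs_def)
  have "NF R \<subseteq> ground_terms R" by (auto simp: NF_def NF_of_def)
  then show ?thesis
    using typed_NF_value[OF R assms(2)] equiv_value_NF[OF R] by blast
qed

end
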